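(* Let $m\geq 2$ and $n\geq 1$ be integers. Write $$\big(P_{m,n}(x)\big)^2=x^k+\sum_{i=0}^{k-1}b_ix^i\quad\text{and}\quad P_{m+1,n}(x)=x^\ell+\sum_{i=0}^{\ell-1}c_ix^i,$$ where $k=2\deg(P_{m,n})=2\deg(G_{m,n})$ and $\ell=\deg(P_{m+1,n})=\deg(G_{m+1,n})$. Then for each integer $i\geq 1$ such that $\lfloor ni/2\rfloor\leq 2^{m-2}-2$, we have $b_{k-i}=c_{\ell-i}$.
   Context: Let $a_i=a_i(c)\in\mathbb{Z}[c]$ be defined by $a_0=0$ and $a_i=a_{i-1}^2+c$ (i.e. $a_i=f_c^i(0)$ with $f_c(z)=z^2+c$). $\mu$ is the Möbius function. For $m\geq 2$, $n\geq 1$, $G_{m,n}\in\mathbb{Z}[c]$ is $\prod_{k\mid n}(a_{m+k-1}+a_{m-1})^{\mu(n/k)}$ if $n\nmid m-1$, and $\prod_{k\mid n}(a_{m+k-1}+a_{m-1})^{\mu(n/k)}\prod_{k\mid n}a_k^{-\mu(n/k)}$ if $n\mid m-1$ (a monic integer polynomial). For a root $\alpha$ of $G_{m,n}$, $\lambda_{m,n}(\alpha)=2^n\prod_{i=0}^{n-1}a_{m+i}(\alpha)$, and the multiplier polynomial is $P_{m,n}(x)=\prod_j(x-\lambda_{m,n}(\alpha_j))\in\mathbb{Z}[x]$, the product over all roots $\alpha_j$ of $G_{m,n}$ with multiplicity. *)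

theory Defs
  imports Complex_Main "HOL-Computational_Algebra.Computational_Algebra"
begin

definition moebius_mu :: "nat \<Rightarrow> int" where
  "moebius_mu n = (if squarefree n then (- 1) ^ card (prime_factors n) else 0)"

text \<open>The critical orbit of \<open>z\<^sup>2 + c\<close>, as polynomials in the variable \<open>c = [:0, 1:]\<close>.\<close>

fun crit_orbit :: "nat \<Rightarrow> int poly" where
  "crit_orbit 0 = 0"
| "crit_orbit (Suc i) = (crit_orbit i)\<^sup>2 + [:0, 1:]"

text \<open>The exponents \<open>\<mu>(n/k)\<close> may be negative, so the product defining \<open>G\<^bsub>m,n\<^esub>\<close> is
  formed in the fraction field of \<open>\<int>[c]\<close>.\<close>

definition misiurewicz_fract :: "nat \<Rightarrow> nat \<Rightarrow> int poly fract" where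
  "misiurewicz_fract m n =
     (\<Prod>k | k dvd n.
        to_fract (crit_orbit (m + k - 1) + crit_orbit (m - 1)) powi moebius_mu (n div k)) *
     (if n dvd m - 1
      then \<Prod>k | k dvd n. to_fract (crit_orbit k) powi (- moebius_mu (n div k))
      else 1)"

text \<open>For \<open>m \<ge> 2\<close> and \<open>n \<ge> 1\<close> the fraction above is a polynomial; it is unique because
  \<^const>\<open>to_fract\<close> is injective.\<close>

definition misiurewicz_poly :: "nat \<Rightarrow> nat \<Rightarrow> int poly" where
  "misiurewicz_poly m n = (THE p. to_fract p = misiurewicz_fract m n)"

definition multiplier :: "nat \<Rightarrow> nat \<Rightarrow> complex \<Rightarrow> complex" where
  "multiplier m n \<alpha> =
     2 ^ n * (\<Prod>i<n. poly (map_poly of_int (crit_orbit (m + i))) \<alpha>)"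

text \<open>The polynomial lies in \<open>\<int>[x]\<close>, but is defined by its complex roots.
  The multiset \<^const>\<open>proots\<close> lists the roots with multiplicity.\<close>

definition multiplier_poly :: "nat \<Rightarrow> nat \<Rightarrow> complex poly" where
  "multiplier_poly m n =
     (\<Prod>\<alpha>\<in>#proots (map_poly of_int (misiurewicz_poly m n)). [:- multiplier m n \<alpha>, 1:])"

end

theory Submission
  imports Defs "HOL-Library.FuncSet"
begin

text \<open>By Newton's identities it suffices to compare power sums of multipliers.  Moebius inversion
  reduces these to the sums \<open>N\<^sub>j\<close> of \<open>\<lambda>\<^sup>e\<close> over the roots of \<open>a\<^bsub>j+k\<^esub> - a\<^sub>j\<close>, and the claim becomes
  \<open>N\<^bsub>m+1\<^esub> - 3 N\<^sub>m + 2 N\<^bsub>m-1\<^esub> = 0\<close>.  Over the Laurent series in \<open>1 / \<surd>- c\<close> the polynomial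
  \<open>f\<^sup>k(w) - w\<close> splits into factors \<open>w - z\<close>, one for each periodic point \<open>z\<close>, and \<open>N\<^sub>j\<close> is up to a constant
  the residue at infinity of the sum over \<open>z\<close> of \<open>\<lambda>(z)\<^sup>e d log (a\<^sub>j - z)\<close>.  Since \<open>z\<close> is of order \<open>\<surd>c\<close> and
  \<open>a\<^bsub>j+1\<^esub> = a\<^sub>j\<^sup>2 + c\<close>, the form \<open>d log (a\<^sub>j - z)\<close> nearly doubles when \<open>j\<close> increases by one; the error is too
  small to meet the residue as long as \<open>\<lambda>\<^sup>e\<close>, of order \<open>c\<^bsup>ke/2\<^esup>\<close>, does not grow too fast.

  That \<open>G\<^bsub>m,n\<^esub>\<close> is a polynomial at all comes from its valuation at each prime \<open>\<pi>\<close> of \<open>\<int>[c]\<close>: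
  \<open>\<pi>\<close> divides \<open>a\<^bsub>m+k-1\<^esub> + a\<^bsub>m-1\<^esub>\<close> to a fixed order if \<open>k\<close> is a multiple of some period, and not at all
  otherwise.\<close>

section \<open>Moebius sums over divisors\<close>

text \<open>Fix a prime \<open>p\<close> dividing \<open>n\<close>. Divisors divisible by the square
  of \<open>p\<close> contribute zero, and the remaining ones pair off as \<open>d\<close> and
  \<open>p * d\<close> with opposite signs.\<close>

lemma sum_moebius_mu:
  assumes "n > 0"
  shows "(\<Sum>d | d dvd n. moebius_mu d) = (if n = 1 then 1 else 0)"
proof (cases "n = 1")
  case True
  have "{d. d dvd (1::nat)} = {1}" by auto
  with True show ?thesis by (simp add: moebius_mu_def)
next
  case False
  then obtain p where p: "prime p" "p dvd n"
    using prime_factor_nat by blast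
  define E where "E = {d. d dvd n \<and> \<not> p dvd d}"
  have fin: "finite {d. d dvd n}" using assms by simp
  have fE: "finite E" unfolding E_def using fin by simp
  have inj: "inj_on ((*) p) E" using p(1) by (auto simp: inj_on_def prime_gt_0_nat)
  have sub: "E \<union> (*) p ` E \<subseteq> {d. d dvd n}"
  proof -
    have "p * d dvd n" if "d \<in> E" for d
    proof -
      have "coprime p d" using that p(1) by (simp add: E_def prime_imp_coprime)
      then show ?thesis using that p(2) by (simp add: E_def divides_mult)
    qed
    then show ?thesis by (auto simp: E_def)
  qed
  have zero: "moebius_mu d = 0" if "d \<in> {d. d dvd n} - (E \<union> (*) p ` E)" for d
  proof -
    have "p dvd d" using that by (auto simp: E_def)
    then obtain q where q: "d = p * q" ..
    have "q dvd n" using that q by (metis DiffD1 dvd_mult_right mem_Collect_eq)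
    then have "p dvd q" using that q by (auto simp: E_def)
    then have "p\<^sup>2 dvd d" using q by (simp add: power2_eq_square)
    then have "\<not> squarefree d" using p(1) by (metis not_prime_unit squarefree_def)
    then show ?thesis by (simp add: moebius_mu_def)
  qed
  have neg: "moebius_mu (p * d) = - moebius_mu d" if "d \<in> E" for d
  proof -
    have cop: "coprime p d" and d0: "d \<noteq> 0" "\<not> p dvd d"
      using that p(1) assms by (auto simp: E_def prime_imp_coprime)
    have sq: "squarefree (p * d) \<longleftrightarrow> squarefree d"
      using cop p(1) squarefree_mult_coprime squarefree_multD(2) squarefree_prime by metis
    have "prime_factors (p * d) = insert p (prime_factors d)"
      using d0(1) p(1) by (auto simp: prime_factors_product prime_prime_factors)
    moreover have "p \<notin> prime_factors d" using d0 by auto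
    ultimately have "card (prime_factors (p * d)) = Suc (card (prime_factors d))" by simp
    then show ?thesis using sq by (simp add: moebius_mu_def)
  qed
  have "(\<Sum>d | d dvd n. moebius_mu d) = (\<Sum>d\<in>E \<union> (*) p ` E. moebius_mu d)"
    using zero sub fin by (intro sum.mono_neutral_right) auto
  also have "\<dots> = (\<Sum>d\<in>E. moebius_mu d) + (\<Sum>d\<in>(*) p ` E. moebius_mu d)"
    using fE by (intro sum.union_disjoint) (auto simp: E_def)
  also have "(\<Sum>d\<in>(*) p ` E. moebius_mu d) = (\<Sum>d\<in>E. - moebius_mu d)"
    using neg by (subst sum.reindex[OF inj]) (auto intro: sum.cong)
  finally show ?thesis using False by (simp add: sum_negf)
qed

text \<open>Only multiples of \<open>p\<close> contribute. With \<open>n = p * q\<close>, the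
  substitution \<open>d = n div k\<close> leaves the full Moebius sum over the divisors of
  \<open>q\<close>. The summand has the shape that the valuations of the orbit sums will
  have.\<close>

lemma sum_moebius_mu_multiples:
  assumes "n > 0"
  shows "(\<Sum>k | k dvd n. moebius_mu (n div k) * (if p dvd k then s else 0)) = (if p = n then s else 0)"
proof (cases "p dvd n")
  case False
  then have "(\<Sum>k | k dvd n. moebius_mu (n div k) * (if p dvd k then s else 0)) = 0"
    by (intro sum.neutral) (auto dest: dvd_trans)
  with False show ?thesis by auto
next
  case True
  then obtain q where q: "n = p * q" ..
  with assms have pos: "p > 0" "q > 0" by auto
  have "(\<Sum>k | k dvd n. moebius_mu (n div k) * (if p dvd k then s else 0))
      = (\<Sum>k | k dvd n \<and> p dvd k. moebius_mu (n div k) * s)"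
    using assms by (intro sum.mono_neutral_cong_right) auto
  also have "\<dots> = (\<Sum>d | d dvd q. moebius_mu d * s)"
    by (rule sum.reindex_bij_witness[of _ "\<lambda>d. n div d" "\<lambda>k. n div k"])
       (use pos q in \<open>auto elim!: dvdE simp: ac_simps\<close>)
  also have "\<dots> = (if q = 1 then s else 0)"
    using sum_moebius_mu[OF pos(2)] by (simp flip: sum_distrib_right)
  also have "q = 1 \<longleftrightarrow> p = n" using pos q by auto
  finally show ?thesis .
qed

lemma moebius_mu_1 [simp]: "moebius_mu 1 = 1"
  by (simp add: moebius_mu_def)

lemma abs_moebius_mu_le_1: "\<bar>moebius_mu n\<bar> \<le> 1"
  by (simp add: moebius_mu_def)

text \<open>The term \<open>k = n\<close> equals \<open>2 ^ (n - 1)\<close>, whereas the others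
  together have absolute value at most \<open>1 + 2 + ... + 2 ^ (n - 2)\<close>, which is one
  less.\<close>

lemma sum_moebius_mu_power2_ge_1:
  assumes "n > 0"
  shows "(\<Sum>k | k dvd n. moebius_mu (n div k) * 2 ^ (k - 1)) \<ge> 1"
proof -
  have geo: "(\<Sum>k = 1..<N. (2::int) ^ (k - 1)) = 2 ^ (N - 1) - 1" if "N \<ge> 1" for N
    using that
  proof (induction N rule: dec_induct)
    case (step N)
    then obtain N' where "N = Suc N'" by (cases N) auto
    then show ?case using step by simp
  qed simp
  have fin: "finite {k. k dvd n}" using assms by simp
  have "- (2 ^ (k - 1)) \<le> moebius_mu (n div k) * 2 ^ (k - 1)" for k
  proof -
    have "(-1) * 2 ^ (k - 1) \<le> moebius_mu (n div k) * 2 ^ (k - 1)"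
      using abs_moebius_mu_le_1[of "n div k"] by (intro mult_right_mono) auto
    then show ?thesis by simp
  qed
  then have "- (\<Sum>k\<in>{k. k dvd n} - {n}. 2 ^ (k - 1))
      \<le> (\<Sum>k\<in>{k. k dvd n} - {n}. moebius_mu (n div k) * 2 ^ (k - 1))"
    unfolding sum_negf[symmetric] by (intro sum_mono)
  moreover have "(\<Sum>k\<in>{k. k dvd n} - {n}. (2::int) ^ (k - 1)) \<le> (\<Sum>k = 1..<n. 2 ^ (k - 1))"
    using assms by (intro sum_mono2) (auto dest: dvd_imp_le intro!: Nat.gr0I)
  moreover have "(\<Sum>k | k dvd n. moebius_mu (n div k) * 2 ^ (k - 1))
      = moebius_mu (n div n) * 2 ^ (n - 1)
        + (\<Sum>k\<in>{k. k dvd n} - {n}. moebius_mu (n div k) * 2 ^ (k - 1))"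
    using fin by (subst sum.remove[of _ n]) auto
  ultimately show ?thesis using geo[of n] assms by (simp add: moebius_mu_1[unfolded One_nat_def])
qed

section \<open>Divisibility in the critical orbit\<close>

text \<open>An arbitrary coefficient ring allows the same iteration in polynomials in
  \<open>c\<close>, in Laurent series and in polynomials over Laurent series.\<close>

primrec quad_iter :: "'a::comm_ring_1 \<Rightarrow> nat \<Rightarrow> 'a \<Rightarrow> 'a" where
  "quad_iter c 0 z = z"
| "quad_iter c (Suc j) z = (quad_iter c j z)\<^sup>2 + c"

lemma quad_iter_add: "quad_iter c (i + j) z = quad_iter c i (quad_iter c j z)"
  by (induction i) auto

lemma crit_orbit_eq_quad_iter: "crit_orbit j = quad_iter [:0, 1:] j 0"
  by (induction j) auto

lemma crit_orbit_add: "crit_orbit (i + j) = quad_iter [:0, 1:] i (crit_orbit j)"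
  by (simp add: crit_orbit_eq_quad_iter quad_iter_add)

text \<open>The iterates of \<open>z\<^sup>2 + c\<close> are even with even derivative, whence the factor \<open>2\<close>.\<close>

lemma quad_iter_reflect:
  fixes c b x :: "'a::comm_ring_1"
  assumes "j \<ge> 1"
  shows "\<exists>\<beta> \<gamma>. quad_iter c j (b - x) = quad_iter c j x + b * (2 * \<beta> + b * \<gamma>)"
  using assms
proof (induction j rule: dec_induct)
  case base
  have "quad_iter c 1 (b - x) = quad_iter c 1 x + b * (2 * (- x) + b * 1)"
    by (simp add: power2_eq_square algebra_simps)
  then show ?case by blast
next
  case (step j)
  then obtain \<beta> \<gamma> where IH: "quad_iter c j (b - x) = quad_iter c j x + b * (2 * \<beta> + b * \<gamma>)"
    by blast
  define y where "y = 2 * \<beta> + b * \<gamma>"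
  have IH': "quad_iter c j (b - x) = quad_iter c j x + b * y"
    using IH by (simp only: y_def)
  have "quad_iter c (Suc j) (b - x)
      = quad_iter c (Suc j) x + b * (2 * (quad_iter c j x * y) + b * y\<^sup>2)"
    by (simp add: IH' power2_eq_square algebra_simps)
  then show ?case by blast
qed

text \<open>With \<open>M = m - 1\<close> these are the first factors of \<open>G_{m,n}\<close>;
  with \<open>M = 0\<close> they are the \<open>a_k\<close> themselves, as \<open>a_0 = 0\<close>.
  Both kinds of factor thus obey one divisibility theory.\<close>

definition orbit_sum :: "nat \<Rightarrow> nat \<Rightarrow> int poly" where
  "orbit_sum M k = crit_orbit (M + k) + crit_orbit M"

lemma orbit_sum_0: "orbit_sum 0 k = crit_orbit k"
  by (simp add: orbit_sum_def)

text \<open>Write \<open>a_{M+k} = s - a_M\<close> with \<open>s = orbit_sum M k\<close>. After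
  \<open>j\<close> more iterations, \<open>quad_iter_reflect\<close> replaces \<open>s - a_M\<close>
  by \<open>a_M\<close> at the cost of a multiple of \<open>s\<close>.\<close>

lemma orbit_sum_add:
  assumes "j \<ge> 1"
  shows "\<exists>\<beta> \<gamma>. orbit_sum M (k + j)
           = orbit_sum M j + orbit_sum M k * (2 * \<beta> + orbit_sum M k * \<gamma>)"
proof -
  obtain \<beta> \<gamma> where "quad_iter [:0, 1:] j (orbit_sum M k - crit_orbit M)
      = quad_iter [:0, 1:] j (crit_orbit M) + orbit_sum M k * (2 * \<beta> + orbit_sum M k * \<gamma>)"
    using quad_iter_reflect[OF assms] by blast
  moreover have "quad_iter [:0, 1:] j (orbit_sum M k - crit_orbit M) = crit_orbit (M + (k + j))"
    using crit_orbit_add[of j "M + k"] by (simp add: orbit_sum_def add_ac)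
  moreover have "quad_iter [:0, 1:] j (crit_orbit M) = crit_orbit (M + j)"
    using crit_orbit_add[of j M] by (simp add: add_ac)
  ultimately show ?thesis by (intro exI[of _ \<beta>] exI[of _ \<gamma>]) (simp add: orbit_sum_def)
qed

section \<open>Degrees and leading coefficients of the orbit polynomials\<close>

lemma crit_orbit_degree:
  shows degree_crit_orbit_Suc: "degree (crit_orbit (Suc i)) = 2 ^ i"
    and lead_coeff_crit_orbit_Suc: "lead_coeff (crit_orbit (Suc i)) = 1"
proof (induction i)
  case (Suc i)
  define P where "P = (crit_orbit (Suc i))\<^sup>2"
  have deg: "degree P = 2 ^ Suc i"
    unfolding P_def using Suc by (subst degree_power_eq) auto
  have lead: "lead_coeff P = 1"
    unfolding P_def lead_coeff_power by (metis Suc.IH(2) power_one)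
  have "(1::nat) < 2 ^ Suc i" by (rule one_less_power) auto
  then have less: "degree [:0, 1 :: int:] < degree P"
    unfolding deg by (simp del: power_Suc)
  have "crit_orbit (Suc (Suc i)) = P + [:0, 1:]" by (simp add: P_def)
  then show "degree (crit_orbit (Suc (Suc i))) = 2 ^ Suc i"
      "lead_coeff (crit_orbit (Suc (Suc i))) = 1"
    using deg lead less by (simp_all add: degree_add_eq_left coeff_eq_0)
qed auto

declare crit_orbit.simps(2) [simp del]

lemma orbit_sum_degree:
  assumes "k \<ge> 1"
  shows "degree (orbit_sum M k) = 2 ^ (M + k - 1)" "lead_coeff (orbit_sum M k) = 1"
proof -
  obtain k' where k: "k = Suc k'" using assms by (cases k) auto
  have big: "degree (crit_orbit (M + k)) = 2 ^ (M + k - 1)" "lead_coeff (crit_orbit (M + k)) = 1"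
    using crit_orbit_degree[of "M + k'"] by (simp_all only: k add_Suc_right diff_Suc_1)
  have "degree (crit_orbit M) < 2 ^ (M + k - 1)"
  proof (cases M)
    case (Suc M')
    have "(2::nat) ^ M' < 2 ^ (M + k - 1)"
      by (rule power_strict_increasing) (simp_all add: Suc k)
    with Suc show ?thesis by (simp add: degree_crit_orbit_Suc)
  qed simp
  with big have "degree (crit_orbit M) < degree (crit_orbit (M + k))" by simp
  then show "degree (orbit_sum M k) = 2 ^ (M + k - 1)" "lead_coeff (orbit_sum M k) = 1"
    using big by (simp_all add: orbit_sum_def degree_add_eq_left coeff_eq_0)
qed

lemma orbit_sum_nonzero: "k \<ge> 1 \<Longrightarrow> orbit_sum M k \<noteq> 0"
  using orbit_sum_degree(2)[of k M] by auto

text \<open>Reduction modulo 2: a divisor of a monic polynomial has an odd leading coefficient and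
  so keeps its degree modulo 2. Dividing \<open>1 + 2 * \<beta>\<close>, it divides 1 there and must
  be constant.\<close>

lemma odd_poly_coprime_monic:
  fixes p :: "int poly"
  assumes "lead_coeff q = 1" "p dvd q" "p dvd 1 + 2 * \<beta>"
  shows "p dvd 1"
proof (rule ccontr)
  assume nu: "\<not> p dvd 1"
  obtain r where r: "q = p * r" using assms(2) ..
  obtain s where s: "1 + 2 * \<beta> = p * s" using assms(3) ..
  have lead: "lead_coeff p * lead_coeff r = 1" using assms(1) r by (simp add: lead_coeff_mult)
  then have odd_lead: "odd (lead_coeff p)" by (metis dvd_mult2 odd_one)
  have deg: "degree p > 0"
  proof (rule ccontr)
    assume "\<not> degree p > 0"
    then have "p = [:lead_coeff p:]" by (simp add: degree_0_id)
    moreover have "lead_coeff p dvd 1" using lead by (metis dvd_triv_left)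
    ultimately have "p dvd 1" by (metis const_poly_dvd_const_poly_iff one_pCons)
    with nu show False ..
  qed
  \<comment> \<open>The largest element \<open>j\<close> of \<open>J\<close> is the degree of
    \<open>s\<close> modulo 2, so the coefficient of \<open>p * s\<close> at
    \<open>degree p + j\<close> will be odd.\<close>
  define J where "J = {i. odd (coeff s i)}"
  have co: "coeff (1 + 2 * \<beta>) i = (if i = 0 then 1 else 0) + 2 * coeff \<beta> i" for i
    unfolding mult_2 coeff_add coeff_1 by simp
  have "J \<subseteq> {..degree s}" by (auto simp: J_def intro: le_degree)
  then have finJ: "finite J" by (rule finite_subset) simp
  have "J \<noteq> {}"
  proof
    assume "J = {}"
    then have "even (coeff (p * s) 0)" by (auto simp: J_def coeff_mult)
    then show False using co[of 0] unfolding s[symmetric] by simp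
  qed
  define j where "j = Max J"
  have above: "even (coeff s i)" if "i > j" for i
    using Max_ge[OF finJ, of i] that by (auto simp: J_def j_def)
  have jodd: "odd (coeff s j)" using Max_in[OF finJ \<open>J \<noteq> {}\<close>] by (simp add: J_def j_def)
  define d where "d = degree p"
  have "coeff (p * s) (d + j)
      = (\<Sum>i\<in>{..d + j} - {d}. coeff p i * coeff s (d + j - i)) + coeff p d * coeff s j"
    by (simp add: coeff_mult sum.remove[of "{..d + j}" d])
  moreover have "even (\<Sum>i\<in>{..d + j} - {d}. coeff p i * coeff s (d + j - i))"
  proof (rule dvd_sum)
    fix i assume "i \<in> {..d + j} - {d}"
    then consider "i < d" | "i > d" by fastforce
    then show "even (coeff p i * coeff s (d + j - i))"
      by cases (use above in \<open>auto simp: d_def coeff_eq_0\<close>)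
  qed
  ultimately have "odd (coeff (p * s) (d + j))" using jodd odd_lead by (simp add: d_def)
  then show False using co[of "d + j"] deg unfolding s[symmetric] by (simp add: d_def)
qed

text \<open>Divisibility by \<open>\<pi>\<close> happens exactly at the multiples of the period \<open>p\<close> of the critical
  orbit modulo \<open>\<pi>\<close>, and always to the same order: passing from \<open>q p\<close> to \<open>(q + 1) p\<close> multiplies
  by \<open>1 + 2\<beta>\<close> modulo \<open>\<pi>\<close>.\<close>

lemma multiplicity_orbit_sum:
  fixes \<pi> :: "int poly"
  assumes "prime_elem \<pi>"
  shows "\<exists>p s. p \<ge> 1 \<and> (\<forall>k\<ge>1. multiplicity \<pi> (orbit_sum M k) = (if p dvd k then s else 0))"
proof (cases "\<exists>k\<ge>1. \<pi> dvd orbit_sum M k")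
  case False
  then show ?thesis
    by (intro exI[of _ 1] exI[of _ 0]) (auto simp: not_dvd_imp_multiplicity_0)
next
  case True
  define p where "p = (LEAST k. k \<ge> 1 \<and> \<pi> dvd orbit_sum M k)"
  have p: "p \<ge> 1" "\<pi> dvd orbit_sum M p"
    using LeastI_ex[OF True[unfolded Bex_def]] by (auto simp: p_def)
  have least: "\<not> \<pi> dvd orbit_sum M k" if "k \<ge> 1" "k < p" for k
    using not_less_Least[of k "\<lambda>k. k \<ge> 1 \<and> \<pi> dvd orbit_sum M k"] that by (auto simp: p_def)
  have period: "\<pi> dvd orbit_sum M (q * p + r) \<longleftrightarrow> \<pi> dvd orbit_sum M r" if "r \<ge> 1" for q r
  proof (induction q)
    case (Suc q)
    have "\<pi> dvd orbit_sum M (p + (q * p + r)) \<longleftrightarrow> \<pi> dvd orbit_sum M (q * p + r)"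
      using orbit_sum_add[of "q * p + r" M p] that p(2)
      by (metis dvd_add_left_iff dvd_mult2 trans_le_add2)
    then show ?case using Suc by (simp add: add_ac)
  qed simp
  \<comment> \<open>Divisibility is carried along because it makes the correction term a multiple of
    \<open>orbit_sum M p\<close>; the new cofactor \<open>u\<close> is then
    \<open>1 + 2 * (y * \<beta>)\<close> modulo \<open>\<pi>\<close>, hence prime to
    \<open>\<pi>\<close>.\<close>
  have same: "orbit_sum M p dvd orbit_sum M (Suc q * p) \<and>
      multiplicity \<pi> (orbit_sum M (Suc q * p)) = multiplicity \<pi> (orbit_sum M p)" for q
  proof (induction q)
    case (Suc q)
    then obtain y where y: "orbit_sum M (Suc q * p) = orbit_sum M p * y" by (auto elim: dvdE)
    obtain \<beta> \<gamma> where step: "orbit_sum M (Suc q * p + p)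
        = orbit_sum M p + orbit_sum M (Suc q * p) * (2 * \<beta> + orbit_sum M (Suc q * p) * \<gamma>)"
      using orbit_sum_add[OF p(1)] by blast
    define u where "u = 1 + 2 * (y * \<beta>) + orbit_sum M p * (y * y * \<gamma>)"
    have eq: "orbit_sum M (Suc (Suc q) * p) = orbit_sum M p * u"
      using step unfolding y by (simp add: u_def algebra_simps)
    have "\<not> \<pi> dvd u"
    proof
      assume "\<pi> dvd u"
      then have "\<pi> dvd 1 + 2 * (y * \<beta>)"
        unfolding u_def using p(2) by (simp add: dvd_add_left_iff)
      then have "\<pi> dvd 1"
        using odd_poly_coprime_monic[OF orbit_sum_degree(2)[OF p(1)] p(2)] by blast
      with assms show False by (simp add: prime_elem_def)
    qed
    moreover from this have "u \<noteq> 0" by auto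
    ultimately show ?case
      using assms orbit_sum_nonzero[OF p(1)]
      unfolding eq by (simp add: prime_elem_multiplicity_mult_distrib not_dvd_imp_multiplicity_0)
  qed simp
  have "multiplicity \<pi> (orbit_sum M k) = (if p dvd k then multiplicity \<pi> (orbit_sum M p) else 0)"
    if "k \<ge> 1" for k
  proof (cases "p dvd k")
    case True
    then obtain r where r: "k = r * p" by (metis dvdE mult.commute)
    with that obtain q where "r = Suc q" by (cases r) auto
    with r have "k = Suc q * p" by simp
    with True show ?thesis using same by simp
  next
    case False
    then have "k mod p \<ge> 1" "k mod p < p"
      using p(1) by (auto simp: mod_eq_0_iff_dvd Suc_le_eq intro: Nat.gr0I)
    then have "\<not> \<pi> dvd orbit_sum M k" using period[of "k mod p" "k div p"] least by simp
    with False show ?thesis by (simp add: not_dvd_imp_multiplicity_0)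
  qed
  with p(1) show ?thesis by blast
qed

lemma crit_orbit_dvd:
  assumes "k dvd n" shows "crit_orbit k dvd crit_orbit n"
proof (cases "k = 0")
  case False
  obtain q where q: "n = q * k" using assms by (metis dvdE mult.commute)
  have "crit_orbit k dvd crit_orbit (q * k)" for q
  proof (induction q)
    case (Suc q)
    show ?case
    proof (cases "q = 0")
      case nz: False
      then obtain \<beta> \<gamma> where "crit_orbit (k + q * k)
          = crit_orbit (q * k) + crit_orbit k * (2 * \<beta> + crit_orbit k * \<gamma>)"
        using orbit_sum_add[of "q * k" 0 k] False by (auto simp: orbit_sum_0)
      moreover from Suc have "crit_orbit k dvd \<dots>" by (intro dvd_add) auto
      ultimately show ?thesis by simp
    qed simp
  qed simp
  with q show ?thesis by simp
qed (use assms in simp)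

text \<open>The Moebius sums collapse: the first to \<open>s\<close> if \<open>p = n\<close>, the
  second to \<open>- s'\<close> if \<open>p' = n\<close> and \<open>n\<close> divides
  \<open>M\<close>, and to 0 otherwise. A negative second sum forces \<open>\<pi>\<close> to divide
  \<open>a_n\<close>, hence \<open>a_M\<close>. Then \<open>p\<close> divides \<open>n\<close> with
  \<open>s' \<le> s\<close>, and \<open>\<pi>\<close> divides \<open>a_{M+p}\<close>, so
  \<open>n\<close> divides \<open>p\<close>. Thus \<open>p = n\<close> and the first sum compensates
  the second.\<close>

lemma misiurewicz_valuation_nonneg:
  fixes \<pi> :: "int poly"
  assumes "prime_elem \<pi>" "n \<ge> 1"
  shows "0 \<le> (\<Sum>k | k dvd n. moebius_mu (n div k) * int (multiplicity \<pi> (orbit_sum M k))) +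
    (\<Sum>k | k dvd n. (if n dvd M then - moebius_mu (n div k) else 0)
       * int (multiplicity \<pi> (crit_orbit k)))" (is "0 \<le> ?A + ?B")
proof -
  obtain p s where p: "p \<ge> 1"
    "\<And>k. k \<ge> 1 \<Longrightarrow> multiplicity \<pi> (orbit_sum M k) = (if p dvd k then s else 0)"
    using multiplicity_orbit_sum[OF assms(1)] by blast
  obtain p' s' where p': "p' \<ge> 1"
    "\<And>k. k \<ge> 1 \<Longrightarrow> multiplicity \<pi> (crit_orbit k) = (if p' dvd k then s' else 0)"
    using multiplicity_orbit_sum[OF assms(1), of 0] by (auto simp: orbit_sum_0)
  have pos: "k \<ge> 1" if "k dvd n" for k using that assms(2) by (auto intro!: Nat.gr0I simp: Suc_le_eq)
  have "?A = (\<Sum>k | k dvd n. moebius_mu (n div k) * (if p dvd k then int s else 0))"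
    by (intro sum.cong) (use p(2) pos in auto)
  also have "\<dots> = (if p = n then int s else 0)"
    using assms(2) by (intro sum_moebius_mu_multiples) simp
  finally have A: "?A = (if p = n then int s else 0)" .
  have B: "?B = - (if p' = n then int s' else 0)" if "n dvd M"
  proof -
    have "?B = - (\<Sum>k | k dvd n. moebius_mu (n div k) * (if p' dvd k then int s' else 0))"
      unfolding sum_negf[symmetric] by (intro sum.cong) (use p'(2) pos that in auto)
    then show ?thesis using sum_moebius_mu_multiples[of n p' "int s'"] assms(2) by simp
  qed
  show ?thesis
  proof (cases "n dvd M \<and> p' = n \<and> s' > 0")
    case False
    moreover have "?B = 0" if "\<not> n dvd M" using that by simp
    ultimately have "?B = 0" using B by (cases "n dvd M") auto
    then show ?thesis using A by simp
  next
    case True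
    then have v: "multiplicity \<pi> (crit_orbit n) = s'" using p'(2)[OF assms(2)] by simp
    have dvd: "crit_orbit n dvd orbit_sum M n"
      using True by (simp add: orbit_sum_def crit_orbit_dvd)
    have "\<pi> dvd crit_orbit n" using v True not_dvd_imp_multiplicity_0[of \<pi> "crit_orbit n"] by auto
    moreover have "crit_orbit n dvd crit_orbit M" using True by (simp add: crit_orbit_dvd)
    ultimately have piM: "\<pi> dvd crit_orbit M" by (rule dvd_trans)
    have "s' \<le> multiplicity \<pi> (orbit_sum M n)"
      using dvd orbit_sum_nonzero[OF assms(2)] v by (metis dvd_imp_multiplicity_le)
    with p(2)[OF assms(2)] True have pn: "p dvd n" "s' \<le> s" by (auto split: if_splits)
    have "\<pi> dvd orbit_sum M p" using p(1) p(2)[OF p(1)] pn True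
        not_dvd_imp_multiplicity_0[of \<pi> "orbit_sum M p"] by auto
    then have "\<pi> dvd crit_orbit (M + p)" using piM by (simp add: orbit_sum_def dvd_add_left_iff)
    then have "p' dvd M + p" using p'(2)[of "M + p"] p(1) assms(1)
        prime_elem_multiplicity_eq_zero_iff[OF assms(1)] crit_orbit_degree[of "M + p - 1"]
      by (cases "crit_orbit (M + p) = 0") (auto split: if_splits)
    then have "n dvd p" using True by (simp add: dvd_add_right_iff)
    with pn have "p = n" by (simp add: dvd_antisym)
    with A B True pn show ?thesis by auto
  qed
qed

section \<open>From valuations to the polynomial \<open>G_{m,n}\<close>\<close>

lemma misiurewicz_fract_eq:
  assumes "m \<ge> 1"
  shows "misiurewicz_fract m n =
    (\<Prod>k | k dvd n. to_fract (orbit_sum (m - 1) k) powi moebius_mu (n div k)) *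
    (\<Prod>k | k dvd n. to_fract (crit_orbit k) powi (if n dvd m - 1 then - moebius_mu (n div k) else 0))"
  using assms by (simp add: misiurewicz_fract_def orbit_sum_def)

text \<open>In the factorial ring Z[c] divisibility is decided by multiplicities at primes, so the
  product of the factors with negative exponent divides that of the factors with positive exponent.
  The second conjunct records this without division.\<close>

lemma prod_powi_eq_to_fract:
  fixes x :: "'i \<Rightarrow> int poly" and e :: "'i \<Rightarrow> int"
  assumes fin: "finite I" and nz: "\<And>i. i \<in> I \<Longrightarrow> x i \<noteq> 0"
    and val: "\<And>\<pi>. prime_elem \<pi> \<Longrightarrow> 0 \<le> (\<Sum>i\<in>I. e i * int (multiplicity \<pi> (x i)))"
  shows "\<exists>g. to_fract g = (\<Prod>i\<in>I. to_fract (x i) powi e i) \<and>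
    g * (\<Prod>i\<in>I. x i ^ nat (- e i)) = (\<Prod>i\<in>I. x i ^ nat (e i))"
proof -
  let ?Y = "\<Prod>i\<in>I. x i ^ nat (- e i)" and ?X = "\<Prod>i\<in>I. x i ^ nat (e i)"
  have nz': "?Y \<noteq> 0" "?X \<noteq> 0" using fin nz by auto
  have mult: "multiplicity \<pi> (\<Prod>i\<in>I. x i ^ f i) = (\<Sum>i\<in>I. f i * multiplicity \<pi> (x i))"
    if "prime_elem \<pi>" for \<pi> and f :: "'i \<Rightarrow> nat"
    using that fin nz
    by (subst prime_elem_multiplicity_prod_distrib)
       (auto simp: prime_elem_multiplicity_power_distrib intro!: sum.cong)
  have "?Y dvd ?X"
  proof (rule multiplicity_le_imp_dvd)
    fix \<pi> :: "int poly" assume "prime \<pi>"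
    then have pe: "prime_elem \<pi>" by simp
    have "0 \<le> (\<Sum>i\<in>I. e i * int (multiplicity \<pi> (x i)))" by (rule val[OF pe])
    also have "\<dots> = (\<Sum>i\<in>I. int (nat (e i)) * int (multiplicity \<pi> (x i)))
         - (\<Sum>i\<in>I. int (nat (- e i)) * int (multiplicity \<pi> (x i)))"
      unfolding sum_subtractf[symmetric] left_diff_distrib[symmetric]
      by (intro sum.cong) auto
    also have "\<dots> = int (multiplicity \<pi> ?X) - int (multiplicity \<pi> ?Y)"
      by (simp add: mult[OF pe])
    finally show "multiplicity \<pi> ?Y \<le> multiplicity \<pi> ?X" by simp
  qed (rule nz')
  then obtain g where g: "?X = ?Y * g" ..
  have to_prod: "to_fract (\<Prod>i\<in>I. x i ^ f i) = (\<Prod>i\<in>I. to_fract (x i) ^ f i)" for f :: "'i \<Rightarrow> nat"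
  proof -
    have pow: "to_fract (y ^ r) = to_fract y ^ r" for y :: "int poly" and r :: nat
      by (induction r) auto
    show ?thesis using fin by (induction I) (auto simp: pow)
  qed
  have "(\<Prod>i\<in>I. to_fract (x i) powi e i) * to_fract ?Y = to_fract ?X"
  proof -
    have "to_fract (x i) powi e i * to_fract (x i) ^ nat (- e i) = to_fract (x i) ^ nat (e i)"
      if "i \<in> I" for i
      using nz[OF that]
      by (cases "e i \<ge> 0") (simp_all add: power_int_def power_inverse)
    then show ?thesis unfolding to_prod prod.distrib[symmetric] by (intro prod.cong) auto
  qed
  also have "\<dots> = to_fract g * to_fract ?Y" unfolding g by simp
  finally have "(\<Prod>i\<in>I. to_fract (x i) powi e i) = to_fract g"
    by (rule iffD1[OF mult_right_cancel, rotated]) (simp only: to_fract_eq_0_iff nz' not_False_eq_True)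
  with g show ?thesis by (intro exI[of _ g]) (simp add: mult.commute)
qed

lemma misiurewicz_poly_mult_eq:
  assumes "m \<ge> 1" "n \<ge> 1"
  shows "misiurewicz_poly m n *
      ((\<Prod>k | k dvd n. orbit_sum (m - 1) k ^ nat (- moebius_mu (n div k))) *
       (\<Prod>k | k dvd n. crit_orbit k ^ nat (if n dvd m - 1 then moebius_mu (n div k) else 0)))
    = (\<Prod>k | k dvd n. orbit_sum (m - 1) k ^ nat (moebius_mu (n div k))) *
      (\<Prod>k | k dvd n. crit_orbit k ^ nat (if n dvd m - 1 then - moebius_mu (n div k) else 0))"
proof -
  let ?D = "{k. k dvd n}"
  \<comment> \<open>The disjoint sum of two copies of the divisors of \<open>n\<close> indexes both
    kinds of factor at once.\<close>
  let ?x = "case_sum (orbit_sum (m - 1)) crit_orbit"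
  let ?e = "case_sum (\<lambda>k. moebius_mu (n div k)) (\<lambda>k. if n dvd m - 1 then - moebius_mu (n div k) else 0)"
  have fin: "finite ?D" using assms by simp
  have pos: "k \<ge> 1" if "k \<in> ?D" for k using that assms(2) by (auto intro!: Nat.gr0I simp: Suc_le_eq)
  have "\<exists>g. to_fract g = (\<Prod>i\<in>?D <+> ?D. to_fract (?x i) powi ?e i) \<and>
      g * (\<Prod>i\<in>?D <+> ?D. ?x i ^ nat (- ?e i)) = (\<Prod>i\<in>?D <+> ?D. ?x i ^ nat (?e i))"
  proof (rule prod_powi_eq_to_fract[of "?D <+> ?D" ?x ?e])
    show "?x i \<noteq> 0" if "i \<in> ?D <+> ?D" for i
      using that pos orbit_sum_nonzero orbit_sum_nonzero[of _ 0] by (auto simp: orbit_sum_0)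
    show "0 \<le> (\<Sum>i\<in>?D <+> ?D. ?e i * int (multiplicity \<pi> (?x i)))" if "prime_elem \<pi>" for \<pi>
      using misiurewicz_valuation_nonneg[OF that assms(2), of "m - 1"] fin
      by (simp add: sum.Plus)
  qed (use fin in auto)
  then obtain g where g': "to_fract g = (\<Prod>i\<in>?D <+> ?D. to_fract (?x i) powi ?e i)"
      and g: "g * (\<Prod>i\<in>?D <+> ?D. ?x i ^ nat (- ?e i)) = (\<Prod>i\<in>?D <+> ?D. ?x i ^ nat (?e i))"
    by blast
  have "to_fract g = misiurewicz_fract m n"
    using fin by (simp add: g' misiurewicz_fract_eq[OF assms(1)] prod.Plus)
  then have "misiurewicz_poly m n = g"
    unfolding misiurewicz_poly_def by (intro the_equality) (metis to_fract_eq_iff)+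
  moreover have "nat (- (if n dvd m - 1 then - y else 0)) = nat (if n dvd m - 1 then y else 0)" for y
    by auto
  ultimately show ?thesis using g fin by (simp add: prod.Plus)
qed

section \<open>Sums over complex roots\<close>

lemma map_poly_of_int_mult:
  "map_poly (of_int :: int \<Rightarrow> 'a::comm_ring_1) (p * q) = map_poly of_int p * map_poly of_int q"
  by (rule poly_eqI) (simp add: coeff_map_poly coeff_mult)

lemma map_poly_of_int_add:
  "map_poly (of_int :: int \<Rightarrow> 'a::comm_ring_1) (p + q) = map_poly of_int p + map_poly of_int q"
  by (rule poly_eqI) (simp add: coeff_map_poly)

lemma map_poly_of_int_power:
  "map_poly (of_int :: int \<Rightarrow> 'a::comm_ring_1) (p ^ n) = map_poly of_int p ^ n"
  by (induction n) (simp_all add: map_poly_of_int_mult)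

lemma degree_map_poly_of_int: "degree (map_poly (of_int :: int \<Rightarrow> complex) p) = degree p"
  by (intro degree_map_poly) auto

lemma map_poly_of_int_eq_0_iff: "map_poly (of_int :: int \<Rightarrow> complex) p = 0 \<longleftrightarrow> p = 0"
  by (intro map_poly_eq_0_iff) auto

lemma map_poly_of_int_crit_orbit:
  "map_poly (of_int :: int \<Rightarrow> complex) (crit_orbit j) = quad_iter [:0, 1:] j 0"
  by (induction j)
     (simp_all add: crit_orbit.simps(2) map_poly_of_int_add map_poly_of_int_power map_poly_pCons)

lemma sum_proots_power:
  fixes g :: "complex \<Rightarrow> 'b::comm_ring_1"
  assumes "p \<noteq> 0"
  shows "(\<Sum>\<alpha>\<in>#proots (p ^ n). g \<alpha>) = of_nat n * (\<Sum>\<alpha>\<in>#proots p. g \<alpha>)"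
  using assms by (induction n) (simp_all add: proots_mult algebra_simps)

lemma sum_proots_prod_power:
  fixes g :: "complex \<Rightarrow> 'b::comm_ring_1"
  assumes "\<And>i. i \<in> I \<Longrightarrow> x i \<noteq> 0"
  shows "(\<Sum>\<alpha>\<in>#proots (map_poly of_int (\<Prod>i\<in>I. x i ^ f i)). g \<alpha>)
       = (\<Sum>i\<in>I. of_nat (f i) * (\<Sum>\<alpha>\<in>#proots (map_poly of_int (x i)). g \<alpha>))"
  using assms
proof (induction I rule: infinite_finite_induct)
  case (insert i I)
  have "map_poly of_int (x i) \<noteq> (0 :: complex poly)" "map_poly of_int (\<Prod>i\<in>I. x i ^ f i) \<noteq> (0 :: complex poly)"
    using insert by (auto simp: map_poly_of_int_eq_0_iff)
  then show ?case using insert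
    by (simp add: map_poly_of_int_mult map_poly_of_int_power proots_mult sum_proots_power)
qed simp_all

lemma of_int_eq_of_nat_diff: "(of_int e :: 'b::comm_ring_1) = of_nat (nat e) - of_nat (nat (- e))"
  by (cases e rule: int_cases2) simp_all

lemma misiurewicz_poly_nonzero:
  assumes "m \<ge> 1" "n \<ge> 1"
  shows "misiurewicz_poly m n \<noteq> 0"
proof
  assume zero: "misiurewicz_poly m n = 0"
  have nz: "orbit_sum M k \<noteq> 0" "crit_orbit k \<noteq> 0" if "k dvd n" for k M
  proof -
    have "k \<ge> 1" using that assms(2) by (cases k) auto
    then show "orbit_sum M k \<noteq> 0" "crit_orbit k \<noteq> 0"
      using orbit_sum_nonzero[of k] by (metis orbit_sum_0)+
  qed
  have "(\<Prod>k | k dvd n. orbit_sum (m - 1) k ^ f k) * (\<Prod>k | k dvd n. crit_orbit k ^ g k) \<noteq> 0" for f g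
    using nz assms(2) by simp
  then show False
    using misiurewicz_poly_mult_eq[OF assms] unfolding zero mult_zero_left by (rule notE[OF _ sym])
qed

text \<open>Sums over roots turn the division-free product identity into a linear one with Moebius
  values as coefficients. The target ring of \<open>g\<close> is left open: the constant 1 gives
  degrees, powers of the multiplier give power sums.\<close>

lemma sum_proots_misiurewicz_poly:
  fixes g :: "complex \<Rightarrow> 'b::comm_ring_1"
  assumes "m \<ge> 1" "n \<ge> 1"
  shows "(\<Sum>\<alpha>\<in>#proots (map_poly of_int (misiurewicz_poly m n)). g \<alpha>) =
    (\<Sum>k | k dvd n. of_int (moebius_mu (n div k)) *
        (\<Sum>\<alpha>\<in>#proots (map_poly of_int (orbit_sum (m - 1) k)). g \<alpha>)) -
    (if n dvd m - 1 then \<Sum>k | k dvd n. of_int (moebius_mu (n div k)) *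
        (\<Sum>\<alpha>\<in>#proots (map_poly of_int (crit_orbit k)). g \<alpha>) else 0)"
proof -
  let ?D = "{k. k dvd n}"
  let ?rs = "\<lambda>p. \<Sum>\<alpha>\<in>#proots (map_poly of_int p). g \<alpha>"
  have pos: "k \<ge> 1" if "k \<in> ?D" for k using that assms(2) by (auto intro!: Nat.gr0I simp: Suc_le_eq)
  have nz: "orbit_sum (m - 1) k \<noteq> 0" "crit_orbit k \<noteq> 0" if "k \<in> ?D" for k
    using pos[OF that] orbit_sum_nonzero orbit_sum_nonzero[of _ 0] by (auto simp: orbit_sum_0)
  have rs_mult: "?rs (p * q) = ?rs p + ?rs q" if "p \<noteq> 0" "q \<noteq> 0" for p q
    using that by (simp add: map_poly_of_int_mult proots_mult map_poly_of_int_eq_0_iff)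
  have nzP: "(\<Prod>k\<in>?D. orbit_sum (m - 1) k ^ f k) \<noteq> 0" "(\<Prod>k\<in>?D. crit_orbit k ^ f k) \<noteq> 0" for f
    using nz assms(2) by auto
  have "?rs (misiurewicz_poly m n) +
      ((\<Sum>k\<in>?D. of_nat (nat (- moebius_mu (n div k))) * ?rs (orbit_sum (m - 1) k)) +
       (\<Sum>k\<in>?D. of_nat (nat (if n dvd m - 1 then moebius_mu (n div k) else 0)) * ?rs (crit_orbit k)))
    = (\<Sum>k\<in>?D. of_nat (nat (moebius_mu (n div k))) * ?rs (orbit_sum (m - 1) k)) +
      (\<Sum>k\<in>?D. of_nat (nat (if n dvd m - 1 then - moebius_mu (n div k) else 0)) * ?rs (crit_orbit k))"
    using arg_cong[OF misiurewicz_poly_mult_eq[OF assms], of ?rs]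
    unfolding rs_mult[OF misiurewicz_poly_nonzero[OF assms] no_zero_divisors[OF nzP]] rs_mult[OF nzP]
    by (simp only: sum_proots_prod_power[OF nz(1)] sum_proots_prod_power[OF nz(2)])
  moreover have conv: "(\<Sum>k\<in>?D. of_int (moebius_mu (n div k)) * h k)
      = (\<Sum>k\<in>?D. of_nat (nat (moebius_mu (n div k))) * h k)
        - (\<Sum>k\<in>?D. of_nat (nat (- moebius_mu (n div k))) * h k)" for h :: "nat \<Rightarrow> 'b"
    unfolding sum_subtractf[symmetric] left_diff_distrib[symmetric]
    by (intro sum.cong refl) (simp only: of_int_eq_of_nat_diff)
  have "x = a1 - a2 - (c2 - c1)" if "x + (a2 + c2) = a1 + c1" for x a1 a2 c1 c2 :: 'b
    using that by (simp add: algebra_simps)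
  ultimately show ?thesis
    unfolding conv by (cases "n dvd m - 1") (simp, simp add: eq_diff_eq)
qed

text \<open>Counting roots, the degree is \<open>2 ^ (m - 1)\<close>, less 1 if \<open>n\<close>
  divides \<open>m - 1\<close>, times a Moebius sum that is at least 1. The bound keeps the indices
  compared in the theorem within the degrees.\<close>

lemma degree_misiurewicz_poly_ge:
  assumes "m \<ge> 1" "n \<ge> 1"
  shows "degree (misiurewicz_poly m n) \<ge> 2 ^ (m - 1) - 1"
proof -
  let ?D = "{k. k dvd n}"
  define S where "S = (\<Sum>k | k dvd n. moebius_mu (n div k) * 2 ^ (k - 1))"
  have pos: "k \<ge> 1" if "k dvd n" for k using that assms(2) by (auto intro!: Nat.gr0I simp: Suc_le_eq)
  have deg: "degree (crit_orbit k) = 2 ^ (k - 1)" if "k dvd n" for k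
    using orbit_sum_degree(1)[of k 0] pos[OF that] by (simp add: orbit_sum_0)
  have card: "(\<Sum>\<alpha>\<in>#proots (map_poly of_int p :: complex poly). 1) = int (degree p)" for p
    by (simp add: size_proots_complex degree_map_poly_of_int)
  have "int (degree (misiurewicz_poly m n)) =
     (\<Sum>k | k dvd n. moebius_mu (n div k) * int (degree (orbit_sum (m - 1) k))) -
     (if n dvd m - 1 then \<Sum>k | k dvd n. moebius_mu (n div k) * int (degree (crit_orbit k)) else 0)"
    using sum_proots_misiurewicz_poly[OF assms, of "\<lambda>_. 1 :: int"] unfolding card by simp
  also have "(\<Sum>k | k dvd n. moebius_mu (n div k) * int (degree (orbit_sum (m - 1) k))) = 2 ^ (m - 1) * S"
    unfolding S_def sum_distrib_left
  proof (intro sum.cong refl)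
    fix k assume "k \<in> ?D"
    then have "k \<ge> 1" using pos by simp
    then show "moebius_mu (n div k) * int (degree (orbit_sum (m - 1) k))
        = 2 ^ (m - 1) * (moebius_mu (n div k) * 2 ^ (k - 1))"
      by (cases k) (simp_all add: orbit_sum_degree power_add)
  qed
  also have "(\<Sum>k | k dvd n. moebius_mu (n div k) * int (degree (crit_orbit k))) = S"
    unfolding S_def by (intro sum.cong) (simp_all add: deg)
  finally have eq: "int (degree (misiurewicz_poly m n)) = (2 ^ (m - 1) - (if n dvd m - 1 then 1 else 0)) * S"
    by (cases "n dvd m - 1") (simp_all add: algebra_simps)
  have "S \<ge> 1" unfolding S_def using assms(2) by (intro sum_moebius_mu_power2_ge_1) simp
  have "(2 ^ (m - 1) - 1) * 1 \<le> (2 ^ (m - 1) - (if n dvd m - 1 then 1 else 0)) * S"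
    using \<open>S \<ge> 1\<close> by (intro mult_mono) auto
  then have "(2 ^ (m - 1) - 1) \<le> int (degree (misiurewicz_poly m n))" by (simp add: eq)
  then have "int (2 ^ (m - 1)) \<le> int (degree (misiurewicz_poly m n) + 1)" by simp
  then show ?thesis by (simp only: of_nat_le_iff le_diff_conv)
qed

section \<open>Newton's identities\<close>

text \<open>The field is arbitrary: the roots will be multipliers in the complex numbers as well as
  periodic points among the Laurent series.\<close>

definition linear_prod :: "'a::field multiset \<Rightarrow> 'a poly" where
  "linear_prod A = (\<Prod>a\<in>#A. [:- a, 1:])"

lemma linear_prod_simps [simp]:
  "linear_prod {#} = 1"
  "linear_prod (add_mset a A) = [:- a, 1:] * linear_prod A"
  "linear_prod (A + B) = linear_prod A * linear_prod B"
  by (simp_all add: linear_prod_def)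

lemma linear_prod_nonzero [simp]: "linear_prod A \<noteq> 0"
  by (induction A) (auto simp del: mult_pCons_left)

lemma degree_linear_prod: "degree (linear_prod A) = size A"
  by (induction A) (simp_all add: degree_mult_eq del: mult_pCons_left)

text \<open>The reflected polynomial is the product of the \<open>1 - a X\<close>. Its logarithmic
  derivative is minus the sum of the geometric series \<open>a / (1 - a X)\<close>, whose
  coefficients are power sums.\<close>

lemma newton_fps:
  fixes A :: "'a::field multiset"
  defines "R \<equiv> \<lambda>A. fps_of_poly (reflect_poly (linear_prod A))"
  shows "fps_deriv (R A) = - (R A) * Abs_fps (\<lambda>s. \<Sum>a\<in>#A. a ^ Suc s)"
proof (induction A)
  case empty
  have "Abs_fps (\<lambda>s. 0) = (0 :: 'a fps)" by (rule fps_ext) simp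
  then show ?case by (simp add: R_def)
next
  case (add a A)
  have refl: "reflect_poly [:- a, 1:] = [:1, - a:]"
    by (cases "a = 0") (simp_all add: reflect_poly_def cCons_def)
  have R: "R (add_mset a A) = (1 - fps_const a * fps_X) * R A"
    by (simp add: R_def reflect_poly_mult refl fps_of_poly_mult fps_of_poly_pCons del: mult_pCons_left)
  have geo: "(1 - fps_const a * fps_X) * Abs_fps (\<lambda>s. a ^ Suc s) = fps_const a"
    by (rule fps_ext) (simp add: left_diff_distrib mult.assoc, simp add: power_eq_if)
  have split: "Abs_fps (\<lambda>s. \<Sum>b\<in>#add_mset a A. b ^ Suc s)
      = Abs_fps (\<lambda>s. a ^ Suc s) + Abs_fps (\<lambda>s. \<Sum>b\<in>#A. b ^ Suc s)"
    by (rule fps_ext) simp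
  have "fps_deriv (R (add_mset a A))
      = - (fps_const a * R A) + (1 - fps_const a * fps_X) * fps_deriv (R A)"
    unfolding R by (simp add: algebra_simps)
  also have "\<dots> = - ((1 - fps_const a * fps_X) * Abs_fps (\<lambda>s. a ^ Suc s) * R A) +
      (1 - fps_const a * fps_X) * (- (R A) * Abs_fps (\<lambda>s. \<Sum>a\<in>#A. a ^ Suc s))"
    unfolding geo add.IH ..
  also have "\<dots> = - R (add_mset a A) * Abs_fps (\<lambda>s. \<Sum>b\<in>#add_mset a A. b ^ Suc s)"
    unfolding R split by (simp add: algebra_simps)
  finally show ?case .
qed

lemma newton_identity:
  fixes A :: "'a::field multiset"
  shows "of_nat (Suc n) * coeff (reflect_poly (linear_prod A)) (Suc n)
    = - (\<Sum>i\<le>n. coeff (reflect_poly (linear_prod A)) i * (\<Sum>a\<in>#A. a ^ (Suc n - i)))"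
proof -
  let ?R = "reflect_poly (linear_prod A)"
  have "of_nat (Suc n) * coeff ?R (Suc n) = fps_deriv (fps_of_poly ?R) $ n" by simp
  also have "\<dots> = - (\<Sum>i = 0..n. coeff ?R i * (\<Sum>a\<in>#A. a ^ Suc (n - i)))"
    unfolding newton_fps by (simp add: fps_mult_nth sum_negf)
  also have "(\<Sum>i = 0..n. coeff ?R i * (\<Sum>a\<in>#A. a ^ Suc (n - i)))
      = (\<Sum>i\<le>n. coeff ?R i * (\<Sum>a\<in>#A. a ^ (Suc n - i)))"
    by (intro sum.cong) (auto simp: Suc_diff_le)
  finally show ?thesis .
qed

lemma lead_coeff_linear_prod [simp]: "lead_coeff (linear_prod A) = 1"
  by (induction A) (simp_all add: lead_coeff_mult del: mult_pCons_left)

text \<open>Newton's identity gives the coefficients recursively; the division by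
  \<open>Suc n\<close> is where characteristic 0 enters.\<close>

lemma power_sums_determine_coeffs:
  fixes A B :: "'a::field_char_0 multiset"
  assumes "\<And>s. 1 \<le> s \<Longrightarrow> s \<le> N \<Longrightarrow> (\<Sum>a\<in>#A. a ^ s) = (\<Sum>b\<in>#B. b ^ s)" "i \<le> N"
  shows "coeff (reflect_poly (linear_prod A)) i = coeff (reflect_poly (linear_prod B)) i"
  using assms(2)
proof (induction i rule: less_induct)
  case (less i)
  show ?case
  proof (cases i)
    case (Suc n)
    have "(of_nat (Suc n) :: 'a) * coeff (reflect_poly (linear_prod A)) (Suc n)
        = of_nat (Suc n) * coeff (reflect_poly (linear_prod B)) (Suc n)"
      unfolding newton_identity
    proof (intro arg_cong[of _ _ uminus] sum.cong refl)
      fix j assume "j \<in> {..n}"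
      then show "coeff (reflect_poly (linear_prod A)) j * (\<Sum>a\<in>#A. a ^ (Suc n - j))
          = coeff (reflect_poly (linear_prod B)) j * (\<Sum>b\<in>#B. b ^ (Suc n - j))"
        using less Suc assms(1)[of "Suc n - j"] by simp
    qed
    then show ?thesis unfolding Suc mult_cancel_left of_nat_eq_0_iff by simp
  qed simp
qed

text \<open>Newton's identity read backwards: the term \<open>i = 0\<close> has coefficient 1, so
  the highest power sum is expressed without division. The subring in view is C[c] inside the
  Laurent series.\<close>

lemma power_sums_in_subring:
  fixes A :: "'a::field multiset"
  assumes coeffs: "\<And>i. coeff (linear_prod A) i \<in> S" and one: "1 \<in> S"
    and closed: "\<And>x y. x \<in> S \<Longrightarrow> y \<in> S \<Longrightarrow> x - y \<in> S" "\<And>x y. x \<in> S \<Longrightarrow> y \<in> S \<Longrightarrow> x * y \<in> S"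
  shows "(\<Sum>a\<in>#A. a ^ s) \<in> S"
proof (induction s rule: less_induct)
  case (less s)
  have zero: "0 \<in> S" using closed(1)[OF one one] by simp
  have minus: "- x \<in> S" if "x \<in> S" for x using closed(1)[OF zero that] by simp
  have add: "x + y \<in> S" if "x \<in> S" "y \<in> S" for x y using closed(1)[OF that(1) minus[OF that(2)]] by simp
  have of_nat: "of_nat k \<in> S" for k by (induction k) (auto intro: zero one add)
  have sum: "sum f I \<in> S" if "\<And>i. i \<in> I \<Longrightarrow> f i \<in> S" for f :: "nat \<Rightarrow> 'a" and I
    using that by (induction I rule: infinite_finite_induct) (auto intro: zero add)
  have R: "coeff (reflect_poly (linear_prod A)) i \<in> S" for i
    by (simp add: coeff_reflect_poly coeffs zero)
  show ?case
  proof (cases s)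
    case 0
    then show ?thesis by (simp add: of_nat)
  next
    case (Suc n)
    have "of_nat (Suc n) * coeff (reflect_poly (linear_prod A)) (Suc n)
        = - ((\<Sum>a\<in>#A. a ^ s)
            + (\<Sum>i\<in>{..n} - {0}. coeff (reflect_poly (linear_prod A)) i * (\<Sum>a\<in>#A. a ^ (Suc n - i))))"
      unfolding newton_identity by (subst sum.remove[of _ 0]) (auto simp: Suc)
    then have "(\<Sum>a\<in>#A. a ^ s) = - (of_nat (Suc n) * coeff (reflect_poly (linear_prod A)) (Suc n))
        - (\<Sum>i\<in>{..n} - {0}. coeff (reflect_poly (linear_prod A)) i * (\<Sum>a\<in>#A. a ^ (Suc n - i)))"
      by (simp only: minus_minus minus_add_distrib diff_conv_add_uminus) (simp add: algebra_simps)
    also have "\<dots> \<in> S"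
      by (intro closed(1) minus closed(2) of_nat R sum less) (auto simp: Suc)
    finally show ?thesis .
  qed
qed

section \<open>Laurent series: orders and logarithmic derivatives\<close>

text \<open>A lower bound on the order that also covers the zero series, whose
  \<open>fls_subdegree\<close> is 0.\<close>

definition fls_vanishes_below :: "int \<Rightarrow> 'a::zero fls \<Rightarrow> bool" where
  "fls_vanishes_below r f \<longleftrightarrow> (\<forall>i<r. fls_nth f i = 0)"

lemma fls_vanishes_below_mono: "fls_vanishes_below r f \<Longrightarrow> s \<le> r \<Longrightarrow> fls_vanishes_below s f"
  by (auto simp: fls_vanishes_below_def)

lemma fls_vanishes_below_0 [simp]: "fls_vanishes_below r 0"
  by (simp add: fls_vanishes_below_def)

lemma fls_vanishes_below_subdegree: "r \<le> fls_subdegree f \<Longrightarrow> fls_vanishes_below r f"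
  by (auto simp: fls_vanishes_below_def)

lemma fls_vanishes_below_iff: "f \<noteq> 0 \<Longrightarrow> fls_vanishes_below r f \<longleftrightarrow> r \<le> fls_subdegree f"
  by (auto simp: fls_vanishes_below_def intro: fls_subdegree_geI)

lemma fls_vanishes_below_add:
  fixes f g :: "'a::ab_group_add fls"
  shows "fls_vanishes_below r f \<Longrightarrow> fls_vanishes_below r g \<Longrightarrow> fls_vanishes_below r (f + g)"
  by (auto simp: fls_vanishes_below_def)

lemma fls_vanishes_below_diff:
  fixes f g :: "'a::ab_group_add fls"
  shows "fls_vanishes_below r f \<Longrightarrow> fls_vanishes_below r g \<Longrightarrow> fls_vanishes_below r (f - g)"
  by (auto simp: fls_vanishes_below_def)

lemma fls_vanishes_below_mult:
  fixes f g :: "'a::field fls"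
  assumes "fls_vanishes_below r f" "fls_vanishes_below s g"
  shows "fls_vanishes_below (r + s) (f * g)"
  using assms by (cases "f = 0 \<or> g = 0") (auto simp: fls_vanishes_below_iff)

lemma fls_vanishes_below_power:
  fixes f :: "'a::field fls"
  assumes "fls_vanishes_below r f"
  shows "fls_vanishes_below (int n * r) (f ^ n)"
proof (induction n)
  case (Suc n)
  then show ?case using fls_vanishes_below_mult[OF assms Suc] by (simp add: algebra_simps)
qed (simp add: fls_vanishes_below_subdegree)

lemma fls_vanishes_below_prod:
  fixes f :: "'i \<Rightarrow> 'a::field fls"
  assumes "\<And>i. i \<in> I \<Longrightarrow> fls_vanishes_below r (f i)"
  shows "fls_vanishes_below (int (card I) * r) (\<Prod>i\<in>I. f i)"
  using assms
proof (induction I rule: infinite_finite_induct)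
  case (insert i I)
  then have "fls_vanishes_below (r + int (card I) * r) (f i * (\<Prod>i\<in>I. f i))"
    by (intro fls_vanishes_below_mult) auto
  then show ?case using insert by (simp add: algebra_simps)
qed (simp_all add: fls_vanishes_below_subdegree)

lemma fls_vanishes_below_divide:
  fixes f g :: "'a::field fls"
  assumes "fls_vanishes_below r f" "g \<noteq> 0"
  shows "fls_vanishes_below (r - fls_subdegree g) (f / g)"
  using assms by (cases "f = 0") (auto simp: fls_vanishes_below_iff fls_divide_subdegree)

lemma fls_vanishes_below_deriv:
  fixes f :: "'a::field fls"
  assumes "fls_vanishes_below r f"
  shows "fls_vanishes_below (r - 1) (fls_deriv f)"
  using assms by (auto simp: fls_vanishes_below_def)

lemma fls_residue_eq_0:
  assumes "fls_vanishes_below 0 f"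
  shows "fls_residue f = 0"
  using assms by (simp add: fls_vanishes_below_def)

lemma fls_residue_sum: "fls_residue (\<Sum>i\<in>I. f i) = (\<Sum>i\<in>I. fls_residue (f i))"
  by (induction I rule: infinite_finite_induct) auto

section \<open>Logarithmic derivatives\<close>

definition fls_dlog :: "'a::field fls \<Rightarrow> 'a fls" where
  "fls_dlog f = fls_deriv f / f"

lemma fls_dlog_mult: "f \<noteq> 0 \<Longrightarrow> g \<noteq> 0 \<Longrightarrow> fls_dlog (f * g) = fls_dlog f + fls_dlog g"
  by (simp add: fls_dlog_def field_simps)

lemma fls_dlog_power: "f \<noteq> 0 \<Longrightarrow> fls_dlog (f ^ n) = of_nat n * fls_dlog f"
proof (induction n)
  case (Suc n)
  then show ?case by (simp add: fls_dlog_mult algebra_simps)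
qed (simp add: fls_dlog_def)

lemma fls_dlog_prod:
  assumes "\<And>i. i \<in> I \<Longrightarrow> f i \<noteq> 0"
  shows "fls_dlog (\<Prod>i\<in>I. f i) = (\<Sum>i\<in>I. fls_dlog (f i))"
  using assms
  by (induction I rule: infinite_finite_induct) (auto simp: fls_dlog_mult, simp_all add: fls_dlog_def)

text \<open>The series \<open>1 + x\<close> has order 0, so dividing by it costs nothing;
  differentiating \<open>x\<close> costs one order.\<close>

lemma fls_dlog_one_plus:
  fixes x :: "'a::field fls"
  assumes "fls_vanishes_below r x" "r > 0"
  shows "1 + x \<noteq> 0" "fls_vanishes_below (r - 1) (fls_dlog (1 + x))"
proof -
  have x0: "fls_nth x i = 0" if "i \<le> 0" for i using assms that by (auto simp: fls_vanishes_below_def)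
  then have sub: "fls_subdegree (1 + x) = 0" by (intro fls_subdegree_eqI) auto
  have "fls_nth (1 + x) 0 = 1" using x0[of 0] by simp
  then show nz: "1 + x \<noteq> 0" by (intro notI) (simp only: fls_zero_nth zero_neq_one)
  show "fls_vanishes_below (r - 1) (fls_dlog (1 + x))"
    using fls_vanishes_below_divide[OF fls_vanishes_below_deriv[OF assms(1)] nz] sub
    by (simp add: fls_dlog_def)
qed

lemma fls_residue_dlog:
  fixes f :: "complex fls"
  assumes "f \<noteq> 0"
  shows "fls_residue (fls_dlog f) = of_int (fls_subdegree f)"
  using fls_residue_deriv_times_inverse_eq_subdegree[of f] assms
  by (simp add: fls_dlog_def divide_inverse)

section \<open>Periodic points at infinity\<close>

text \<open>Expansion at \<open>c = \<infinity>\<close>: with \<open>X = 1 / t\<close> the parameter \<open>c = - t\<^sup>2\<close> becomes the Laurent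
  series \<open>- X\<^sup>-\<^sup>2\<close>, so that \<open>\<surd>- c\<close> is available.\<close>

definition fls_c :: "complex fls" where
  "fls_c = - (fls_X_inv ^ 2)"

definition fls_of_param_poly :: "complex poly \<Rightarrow> complex fls" where
  "fls_of_param_poly p = poly (map_poly fls_const p) fls_c"

lemma fls_of_param_poly_0 [simp]: "fls_of_param_poly 0 = 0"
  by (simp add: fls_of_param_poly_def)

lemma fls_of_param_poly_pCons [simp]:
  "fls_of_param_poly (pCons a p) = fls_const a + fls_c * fls_of_param_poly p"
  by (simp add: fls_of_param_poly_def map_poly_pCons)

lemma fls_of_param_poly_1 [simp]: "fls_of_param_poly 1 = 1"
  by (simp add: one_pCons)

lemma fls_of_param_poly_add [simp]:
  "fls_of_param_poly (p + q) = fls_of_param_poly p + fls_of_param_poly q"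
  by (induction p q rule: poly_induct2) (simp_all add: algebra_simps flip: fls_plus_const)

lemma fls_of_param_poly_smult [simp]:
  "fls_of_param_poly (smult a p) = fls_const a * fls_of_param_poly p"
  by (induction p) (simp_all add: algebra_simps)

lemma fls_of_param_poly_diff [simp]:
  "fls_of_param_poly (p - q) = fls_of_param_poly p - fls_of_param_poly q"
  using fls_of_param_poly_add[of "p - q" q] by (simp add: algebra_simps del: fls_of_param_poly_add)

lemma fls_of_param_poly_mult [simp]:
  "fls_of_param_poly (p * q) = fls_of_param_poly p * fls_of_param_poly q"
  by (induction p) (simp_all add: algebra_simps)

lemma fls_of_param_poly_power [simp]: "fls_of_param_poly (p ^ n) = fls_of_param_poly p ^ n"
  by (induction n) simp_all

lemma fls_of_param_poly_prod [simp]: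
  "fls_of_param_poly (\<Prod>i\<in>I. f i) = (\<Prod>i\<in>I. fls_of_param_poly (f i))"
  by (induction I rule: infinite_finite_induct) simp_all

lemma fls_of_param_poly_quad_iter:
  "fls_of_param_poly (quad_iter [:0, 1:] j p) = quad_iter fls_c j (fls_of_param_poly p)"
  by (induction j) simp_all

section \<open>Sums over roots as residues at infinity\<close>

lemma fls_c_mult_nth: "fls_nth (fls_c * f) i = - fls_nth f (i + 2)"
  by (simp add: fls_c_def fls_X_inv_power_times_conv_shift)

lemma fls_of_param_poly_nth_pos: "i > 0 \<Longrightarrow> fls_nth (fls_of_param_poly p) i = 0"
  by (induction p arbitrary: i) (simp_all add: fls_c_mult_nth)

lemma fls_deriv_c: "fls_deriv fls_c = 2 * fls_X_inv ^ 3"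
  by (simp add: fls_c_def fls_deriv_X_inv_power eval_nat_numeral)

text \<open>The derivative of \<open>c\<close> is \<open>2 X^-3\<close>, and a polynomial in
  \<open>c = - X^-2\<close> has no positive powers of \<open>X\<close>, so the product has no term
  \<open>X^-1\<close>.\<close>

lemma fls_residue_param_poly_deriv_c: "fls_residue (fls_of_param_poly p * fls_deriv fls_c) = 0"
proof -
  have "fls_of_param_poly p * fls_deriv fls_c = fls_const 2 * (fls_of_param_poly p * fls_X_inv ^ 3)"
    unfolding fls_deriv_c by (simp only: fls_const_numeral mult.left_commute)
  then have "fls_residue (fls_of_param_poly p * fls_deriv fls_c)
      = 2 * fls_nth (fls_of_param_poly p) 2"
    by (simp only: fls_residue_fls_const_times fls_X_inv_power_times_conv_shift fls_residue_def
        fls_mult_const_nth fls_shift_nth) simp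
  then show ?thesis by (simp only: fls_of_param_poly_nth_pos) simp
qed

lemma fls_deriv_param_poly:
  "fls_deriv (fls_of_param_poly p) = fls_of_param_poly (pderiv p) * fls_deriv fls_c"
  by (induction p) (simp_all add: pderiv_pCons algebra_simps)

lemma fls_c_subdegree: "fls_subdegree fls_c = -2"
  by (simp add: fls_c_def)

lemma fls_c_minus_const:
  shows "fls_c - fls_const a \<noteq> 0" "fls_subdegree (fls_c - fls_const a) = -2"
proof -
  show sub: "fls_subdegree (fls_c - fls_const a) = -2"
    by (intro fls_subdegree_eqI) (auto simp: fls_c_def)
  then show "fls_c - fls_const a \<noteq> 0" by auto
qed

lemma fls_of_linear_prod_nonzero: "fls_of_param_poly (linear_prod A) \<noteq> 0"
proof (induction A)
  case (add a A)
  then show ?case using fls_c_minus_const(1)[of a] by (simp del: mult_pCons_left)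
qed simp

text \<open>The residue theorem at infinity: writing \<open>g = (c - a) q + g(a)\<close> for each
  root \<open>a\<close> splits off the polynomial differential \<open>q dc\<close>, which has no
  residue. The factor -2 is the order of \<open>c - a\<close> in \<open>X\<close>.\<close>

lemma sum_linear_prod_eq_residue:
  "fls_residue (fls_of_param_poly g * fls_dlog (fls_of_param_poly (linear_prod A)))
     = - 2 * (\<Sum>\<alpha>\<in>#A. poly g \<alpha>)"
proof (induction A)
  case empty
  show ?case by (simp add: fls_dlog_def)
next
  case (add a A)
  define L where "L = fls_c - fls_const a"
  have L: "L \<noteq> 0" "fls_subdegree L = -2" using fls_c_minus_const by (auto simp: L_def)
  have Lp: "fls_of_param_poly [:- a, 1:] = L" by (simp add: L_def)
  have g: "fls_of_param_poly g = L * fls_of_param_poly (synthetic_div g a) + fls_const (poly g a)"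
    by (subst synthetic_div_correct'[of a g, symmetric])
       (simp only: fls_of_param_poly_add fls_of_param_poly_mult Lp, simp)
  have dL: "fls_dlog L = fls_deriv fls_c / L" by (simp add: fls_dlog_def L_def)
  have "fls_of_param_poly g * fls_dlog L
      = fls_of_param_poly (synthetic_div g a) * fls_deriv fls_c + fls_const (poly g a) * fls_dlog L"
    unfolding g distrib_right using L(1) by (simp add: dL)
  then have "fls_residue (fls_of_param_poly g * fls_dlog L)
      = fls_residue (fls_of_param_poly (synthetic_div g a) * fls_deriv fls_c)
        + poly g a * fls_residue (fls_dlog L)"
    by (simp only: fls_residue_add fls_residue_fls_const_times)
  also have "\<dots> = - 2 * poly g a"
    by (simp only: fls_residue_param_poly_deriv_c fls_residue_dlog[OF L(1)] L(2)) simp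
  finally have "fls_residue (fls_of_param_poly g * fls_dlog L) = - 2 * poly g a" .
  moreover have "fls_dlog (fls_of_param_poly (linear_prod (add_mset a A)))
      = fls_dlog L + fls_dlog (fls_of_param_poly (linear_prod A))"
    by (simp only: linear_prod_simps fls_of_param_poly_mult Lp)
       (intro fls_dlog_mult L fls_of_linear_prod_nonzero)
  ultimately show ?case
    using add.IH by (simp only: distrib_left fls_residue_add) simp
qed

lemma sum_proots_eq_residue:
  assumes "p \<noteq> 0"
  shows "fls_residue (fls_of_param_poly g * fls_dlog (fls_of_param_poly p))
     = - 2 * (\<Sum>\<alpha>\<in>#proots p. poly g \<alpha>)"
proof -
  have p: "p = smult (lead_coeff p) (linear_prod (proots p))"
    unfolding linear_prod_def by (rule complex_poly_decompose_multiset[symmetric])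
  have "fls_dlog (fls_of_param_poly p) = fls_dlog (fls_of_param_poly (linear_prod (proots p)))"
    using assms by (subst p) (simp add: fls_dlog_def fls_of_linear_prod_nonzero
        fls_deriv_mult_const_left)
  then show ?thesis by (simp add: sum_linear_prod_eq_residue del: fls_residue_def)
qed

section \<open>Orders of periodic Laurent series\<close>

lemma quad_iter_subdegree:
  assumes "fls_subdegree z < -1"
  shows "fls_subdegree (quad_iter fls_c j z) = 2 ^ j * fls_subdegree z"
proof (induction j)
  case (Suc j)
  let ?w = "quad_iter fls_c j z"
  have "(1::int) * 2 \<le> 2 ^ j * (- fls_subdegree z)" using assms by (intro mult_mono) auto
  then have le: "2 ^ j * fls_subdegree z \<le> - 2" by simp
  then have nz: "?w \<noteq> 0" using Suc by auto
  have "fls_subdegree (?w\<^sup>2) = 2 * (2 ^ j * fls_subdegree z)"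
    using Suc by (simp add: fls_subdegree_pow)
  moreover from this have "fls_subdegree (?w\<^sup>2) < fls_subdegree fls_c"
    using le unfolding fls_c_subdegree by linarith
  ultimately show ?case using nz by (simp add: fls_subdegree_add_eq1)
qed simp

definition fls_periodic :: "nat \<Rightarrow> complex fls set" where
  "fls_periodic k = {z. quad_iter fls_c k z = z}"

lemma fls_periodic_quad_iter:
  assumes "z \<in> fls_periodic k"
  shows "quad_iter fls_c j z \<in> fls_periodic k"
  using assms quad_iter_add[of fls_c k j z] quad_iter_add[of fls_c j k z]
  by (simp add: fls_periodic_def add.commute)

text \<open>A pole of order at least 2 doubles its order at each step, since the square then
  dominates \<open>c\<close>, so such a series never returns to itself.\<close>

lemma fls_periodic_vanishes_below:
  assumes "z \<in> fls_periodic k" "k \<ge> 1"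
  shows "fls_vanishes_below (-1) z"
proof (rule ccontr)
  assume "\<not> ?thesis"
  then have sub: "fls_subdegree z < -1"
    using fls_vanishes_below_subdegree[of "-1" z] by linarith
  then have "fls_subdegree z = 2 ^ k * fls_subdegree z"
    using quad_iter_subdegree[OF sub, of k] assms by (simp add: fls_periodic_def)
  then have "(2::int) ^ k = 1" using sub by simp
  then show False using assms(2) one_less_power[of "2::int" k] by simp
qed

text \<open>The periodic points are found by their itineraries: \<open>z\<^sub>j = e\<^sub>j t u\<^sub>j\<close> with \<open>e\<^sub>j = \<plusminus>1\<close> and
  \<open>u\<^sub>j\<^sup>2 = 1 + e\<^bsub>j+1\<^esub> X u\<^bsub>j+1\<^esub>\<close>, which determines the coefficients of all \<open>u\<^sub>j\<close> recursively.\<close>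

function itinerary_coeff :: "(nat \<Rightarrow> complex) \<Rightarrow> nat \<Rightarrow> nat \<Rightarrow> complex" where
  "itinerary_coeff e j 0 = 1"
| "itinerary_coeff e j (Suc n) = (e (Suc j) * itinerary_coeff e (Suc j) n
     - (\<Sum>i = 1..n. itinerary_coeff e j i * itinerary_coeff e j (Suc n - i))) / 2"
  by pat_completeness auto
termination by (relation "measure (\<lambda>(e, j, n). n)") auto

lemma itinerary_coeff_square:
  "(Abs_fps (itinerary_coeff e j))\<^sup>2
     = 1 + fps_const (e (Suc j)) * fps_X * Abs_fps (itinerary_coeff e (Suc j))"
proof (rule fps_ext)
  fix n
  show "(Abs_fps (itinerary_coeff e j))\<^sup>2 $ n
     = (1 + fps_const (e (Suc j)) * fps_X * Abs_fps (itinerary_coeff e (Suc j))) $ n"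
  proof (cases n)
    case 0
    then show ?thesis by (simp add: power2_eq_square mult.assoc)
  next
    case (Suc r)
    have "(Abs_fps (itinerary_coeff e j))\<^sup>2 $ Suc r
        = (\<Sum>i = 0..Suc r. itinerary_coeff e j i * itinerary_coeff e j (Suc r - i))"
      by (simp add: power2_eq_square fps_mult_nth del: sum.atLeast0_atMost_Suc)
    also have "\<dots> = 2 * itinerary_coeff e j (Suc r)
        + (\<Sum>i = 1..r. itinerary_coeff e j i * itinerary_coeff e j (Suc r - i))"
      by (simp add: sum.atLeast_Suc_atMost[of 0] del: itinerary_coeff.simps(2))
    also have "\<dots> = e (Suc j) * itinerary_coeff e (Suc j) r"
      by (simp add: diff_divide_distrib)
    finally show ?thesis by (simp add: Suc mult.assoc)
  qed
qed

lemma itinerary_coeff_periodic: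
  assumes "\<And>i. e (i + k) = e i"
  shows "itinerary_coeff e (j + k) n = itinerary_coeff e j n"
proof (induction n arbitrary: j rule: less_induct)
  case (less n)
  show ?case
  proof (cases n)
    case (Suc r)
    have "itinerary_coeff e (Suc (j + k)) r = itinerary_coeff e (Suc j) r"
      using less[of r "Suc j"] Suc by simp
    moreover have "e (Suc (j + k)) = e (Suc j)" using assms[of "Suc j"] by simp
    moreover have "(\<Sum>i = 1..r. itinerary_coeff e (j + k) i * itinerary_coeff e (j + k) (Suc r - i))
        = (\<Sum>i = 1..r. itinerary_coeff e j i * itinerary_coeff e j (Suc r - i))"
      using less Suc by (intro sum.cong) auto
    ultimately show ?thesis unfolding Suc itinerary_coeff.simps by simp
  qed simp
qed

definition itinerary_point :: "(nat \<Rightarrow> complex) \<Rightarrow> nat \<Rightarrow> complex fls" where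
  "itinerary_point e j = fls_const (e j) * fls_X_inv * fps_to_fls (Abs_fps (itinerary_coeff e j))"

text \<open>By the equation for \<open>u_j^2\<close>, the square is \<open>t^2\<close> plus the next
  point, and \<open>c = - t^2\<close> removes the first term.\<close>

lemma itinerary_point_step:
  assumes "(e j)\<^sup>2 = 1"
  shows "(itinerary_point e j)\<^sup>2 + fls_c = itinerary_point e (Suc j)"
proof -
  have const: "fls_const (e j) ^ 2 = 1" using assms by (simp flip: fls_const_power)
  have X: "fls_X_inv * fls_X = (1 :: complex fls)" by (simp add: fls_X_times_conv_shift)
  have "(itinerary_point e j)\<^sup>2
      = fls_X_inv ^ 2 * fps_to_fls ((Abs_fps (itinerary_coeff e j))\<^sup>2)"
    by (simp add: itinerary_point_def power_mult_distrib const fps_to_fls_power)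
  also have "\<dots> = fls_X_inv ^ 2 + fls_const (e (Suc j)) * fls_X_inv * (fls_X_inv * fls_X)
      * fps_to_fls (Abs_fps (itinerary_coeff e (Suc j)))"
    unfolding itinerary_coeff_square
    by (simp add: fls_times_fps_to_fls power2_eq_square algebra_simps)
  finally show ?thesis by (simp add: X fls_c_def itinerary_point_def)
qed

lemma itinerary_point_iter:
  assumes "\<And>j. (e j)\<^sup>2 = 1"
  shows "quad_iter fls_c i (itinerary_point e j) = itinerary_point e (i + j)"
  by (induction i) (simp_all add: itinerary_point_step assms)

lemma itinerary_point_nth: "fls_nth (itinerary_point e j) (- 1) = e j"
proof -
  have "itinerary_point e j
      = fls_X_inv * (fls_const (e j) * fps_to_fls (Abs_fps (itinerary_coeff e j)))"
    by (simp add: itinerary_point_def ac_simps)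
  then show ?thesis by (simp add: fls_X_inv_times_conv_shift)
qed

section \<open>Splitting of \<open>f^k(w) - w\<close> over the Laurent series\<close>

definition fls_iter_poly :: "nat \<Rightarrow> complex fls poly" where
  "fls_iter_poly j = quad_iter [:fls_c:] j [:0, 1:]"

lemma poly_fls_iter_poly: "poly (fls_iter_poly j) z = quad_iter fls_c j z"
  unfolding fls_iter_poly_def by (induction j) simp_all

lemma degree_fls_iter_poly:
  shows "degree (fls_iter_poly j) = 2 ^ j" "lead_coeff (fls_iter_poly j) = 1"
proof (induction j)
  case (Suc j)
  define P where "P = (fls_iter_poly j)\<^sup>2"
  have deg: "degree P = 2 ^ Suc j"
    unfolding P_def using Suc by (subst degree_power_eq) auto
  have lead: "lead_coeff P = 1"
    unfolding P_def lead_coeff_power by (metis Suc.IH(2) power_one)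
  have less: "degree [:fls_c:] < degree P" unfolding deg by simp
  have "fls_iter_poly (Suc j) = P + [:fls_c:]" by (simp add: P_def fls_iter_poly_def)
  then show "degree (fls_iter_poly (Suc j)) = 2 ^ Suc j" "lead_coeff (fls_iter_poly (Suc j)) = 1"
    using deg lead less by (simp_all add: degree_add_eq_left coeff_eq_0)
qed (simp_all add: fls_iter_poly_def)

lemma fls_periodic_poly:
  assumes "k \<ge> 1"
  shows "degree (fls_iter_poly k - [:0, 1:]) = 2 ^ k"
    and "lead_coeff (fls_iter_poly k - [:0, 1:]) = 1"
    and "fls_periodic k = {z. poly (fls_iter_poly k - [:0, 1:]) z = 0}"
proof -
  have "(1::nat) < 2 ^ k" using assms by (intro one_less_power) auto
  then have less: "degree [:0, 1 :: complex fls:] < degree (fls_iter_poly k)"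
    by (simp add: degree_fls_iter_poly)
  from less have "degree (fls_iter_poly k + - [:0, 1:]) = degree (fls_iter_poly k)"
    by (intro degree_add_eq_left) simp
  then show deg: "degree (fls_iter_poly k - [:0, 1:]) = 2 ^ k"
    by (simp only: diff_conv_add_uminus degree_fls_iter_poly)
  show "lead_coeff (fls_iter_poly k - [:0, 1:]) = 1"
    unfolding deg using less degree_fls_iter_poly[of k] by (simp add: coeff_eq_0)
  show "fls_periodic k = {z. poly (fls_iter_poly k - [:0, 1:]) z = 0}"
    by (auto simp: fls_periodic_def poly_fls_iter_poly)
qed

lemma finite_fls_periodic:
  assumes "k \<ge> 1"
  shows "finite (fls_periodic k)"
proof -
  have "fls_iter_poly k - [:0, 1:] \<noteq> 0" using fls_periodic_poly(2)[OF assms] by auto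
  then show ?thesis unfolding fls_periodic_poly(3)[OF assms] by (rule poly_roots_finite)
qed

text \<open>Each of the \<open>2 ^ k\<close> sign words of length \<open>k\<close>, repeated
  periodically, yields a periodic point. Distinct words give distinct points because the
  coefficients of \<open>t\<close> along the orbit recover the signs.\<close>

lemma card_fls_periodic:
  assumes "k \<ge> 1"
  shows "card (fls_periodic k) \<ge> 2 ^ k"
proof -
  define E where "E = PiE {..<k} (\<lambda>_. {1, - 1 :: complex})"
  define per where "per = (\<lambda>(f :: nat \<Rightarrow> complex) i. f (i mod k))"
  have sq: "(per f j)\<^sup>2 = 1" if "f \<in> E" for f j
  proof -
    have "j mod k \<in> {..<k}" using assms by simp
    then have "f (j mod k) \<in> {1, - 1}" using that unfolding E_def by (rule PiE_mem[rotated])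
    then show ?thesis by (auto simp: per_def)
  qed
  have "card E = 2 ^ k" by (simp add: E_def card_PiE numeral_2_eq_2)
  moreover have "(\<lambda>f. itinerary_point (per f) 0) ` E \<subseteq> fls_periodic k"
  proof safe
    fix f assume "f \<in> E"
    then have "quad_iter fls_c k (itinerary_point (per f) 0) = itinerary_point (per f) k"
      using itinerary_point_iter[of "per f" k 0] sq by simp
    also have "itinerary_coeff (per f) k = itinerary_coeff (per f) 0"
      using itinerary_coeff_periodic[of "per f" k 0] by (intro ext) (simp add: per_def)
    then have "itinerary_point (per f) k = itinerary_point (per f) 0"
      unfolding itinerary_point_def by (simp add: per_def)
    finally show "itinerary_point (per f) 0 \<in> fls_periodic k" by (simp add: fls_periodic_def)
  qed
  moreover have "inj_on (\<lambda>f. itinerary_point (per f) 0) E"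
  proof (rule inj_onI)
    fix f g assume fg: "f \<in> E" "g \<in> E" "itinerary_point (per f) 0 = itinerary_point (per g) 0"
    then have "itinerary_point (per f) j = itinerary_point (per g) j" for j
      using itinerary_point_iter[of "per f" j 0] itinerary_point_iter[of "per g" j 0] sq by simp
    then have "per f j = per g j" for j by (metis itinerary_point_nth)
    then have "f j = g j" if "j < k" for j
      using that unfolding per_def by (metis mod_less)
    then show "f = g" using fg(1,2) unfolding E_def by (intro PiE_ext[of f]) auto
  qed
  ultimately show ?thesis
    using finite_fls_periodic[OF assms] by (metis card_image card_mono)
qed

text \<open>A monic polynomial of degree \<open>2 ^ k\<close> for which \<open>2 ^ k\<close>
  distinct roots have been found.\<close>

lemma fls_iter_poly_split:
  assumes "k \<ge> 1"
  shows "fls_iter_poly k - [:0, 1:] = linear_prod (mset_set (fls_periodic k))"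
proof (rule poly_eqI_degree_lead_coeff[where A = "fls_periodic k" and n = "2 ^ k"])
  let ?F = "fls_iter_poly k - [:0, 1:]"
  have fin: "finite (fls_periodic k)" by (rule finite_fls_periodic[OF assms])
  have F0: "?F \<noteq> 0" using fls_periodic_poly(2)[OF assms] by auto
  have "card (fls_periodic k) \<le> 2 ^ k"
    unfolding fls_periodic_poly(3)[OF assms]
    using card_poly_roots_bound[OF F0] fls_periodic_poly(1)[OF assms] by simp
  with card_fls_periodic[OF assms] have card: "card (fls_periodic k) = 2 ^ k" by simp
  have deg: "degree (linear_prod (mset_set (fls_periodic k))) = 2 ^ k"
    by (simp add: degree_linear_prod card)
  show "coeff ?F (2 ^ k) = coeff (linear_prod (mset_set (fls_periodic k))) (2 ^ k)"
    using fls_periodic_poly(1,2)[OF assms] lead_coeff_linear_prod deg by metis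
  show "2 ^ k \<le> card (fls_periodic k)" "degree ?F \<le> 2 ^ k"
      "degree (linear_prod (mset_set (fls_periodic k))) \<le> 2 ^ k"
    using card fls_periodic_poly(1)[OF assms] deg by simp_all
  show "poly ?F z = poly (linear_prod (mset_set (fls_periodic k))) z" if "z \<in> fls_periodic k" for z
  proof -
    have "poly (linear_prod (mset_set (fls_periodic k))) z = (\<Prod>a\<in>fls_periodic k. z - a)"
      by (simp add: linear_prod_def poly_prod prod_unfold_prod_mset[symmetric])
    also have "\<dots> = 0" using fin that by (auto intro!: prod_zero)
    finally show ?thesis using that unfolding fls_periodic_poly(3)[OF assms] by simp
  qed
qed

lemma quad_iter_minus_self:
  assumes "k \<ge> 1"
  shows "quad_iter fls_c k w - w = (\<Prod>z\<in>fls_periodic k. w - z)"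
proof -
  have "quad_iter fls_c k w - w = poly (fls_iter_poly k - [:0, 1:]) w"
    by (simp add: poly_fls_iter_poly)
  also have "\<dots> = (\<Prod>z\<in>fls_periodic k. w - z)"
    unfolding fls_iter_poly_split[OF assms]
    by (simp add: linear_prod_def poly_prod prod_unfold_prod_mset[symmetric])
  finally show ?thesis .
qed

section \<open>Traces over the periodic points\<close>

text \<open>The copy of C[c] is treated as a subset of the Laurent series, since the roots of these
  polynomials live only in the larger field.\<close>

definition param_ring_poly :: "complex fls poly \<Rightarrow> bool" where
  "param_ring_poly p \<longleftrightarrow> (\<forall>i. coeff p i \<in> range fls_of_param_poly)"

lemma range_fls_of_param_poly:
  shows "0 \<in> range fls_of_param_poly" "1 \<in> range fls_of_param_poly" "fls_c \<in> range fls_of_param_poly"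
    and "x \<in> range fls_of_param_poly \<Longrightarrow> y \<in> range fls_of_param_poly \<Longrightarrow> x + y \<in> range fls_of_param_poly"
    and "x \<in> range fls_of_param_poly \<Longrightarrow> y \<in> range fls_of_param_poly \<Longrightarrow> x - y \<in> range fls_of_param_poly"
    and "x \<in> range fls_of_param_poly \<Longrightarrow> y \<in> range fls_of_param_poly \<Longrightarrow> x * y \<in> range fls_of_param_poly"
proof -
  show "0 \<in> range fls_of_param_poly" by (metis fls_of_param_poly_0 rangeI)
  show "1 \<in> range fls_of_param_poly" by (metis fls_of_param_poly_1 rangeI)
  have "fls_of_param_poly [:0, 1:] = fls_c" by simp
  then show "fls_c \<in> range fls_of_param_poly" by (metis rangeI)
qed (auto simp flip: fls_of_param_poly_add fls_of_param_poly_diff fls_of_param_poly_mult)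

lemma param_ring_poly_pCons:
  "param_ring_poly (pCons a p) \<longleftrightarrow> a \<in> range fls_of_param_poly \<and> param_ring_poly p"
  by (auto simp: param_ring_poly_def coeff_pCons split: nat.splits)

lemma param_ring_poly_0: "param_ring_poly 0"
  by (simp add: param_ring_poly_def range_fls_of_param_poly)

lemma param_ring_poly_1: "param_ring_poly 1"
  by (simp add: one_pCons param_ring_poly_pCons param_ring_poly_0 range_fls_of_param_poly)

lemma param_ring_poly_add: "param_ring_poly p \<Longrightarrow> param_ring_poly q \<Longrightarrow> param_ring_poly (p + q)"
  unfolding param_ring_poly_def by (simp add: range_fls_of_param_poly(4))

lemma param_ring_poly_diff: "param_ring_poly p \<Longrightarrow> param_ring_poly q \<Longrightarrow> param_ring_poly (p - q)"
  unfolding param_ring_poly_def by (simp add: range_fls_of_param_poly(5))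

lemma param_ring_poly_mult:
  assumes "param_ring_poly p" "param_ring_poly q"
  shows "param_ring_poly (p * q)"
  unfolding param_ring_poly_def coeff_mult
proof
  fix n
  have "(\<Sum>i\<in>I. coeff p i * coeff q (n - i)) \<in> range fls_of_param_poly" if "finite I" for I
    using that assms unfolding param_ring_poly_def
    by (induction I) (auto intro!: range_fls_of_param_poly)
  then show "(\<Sum>i\<le>n. coeff p i * coeff q (n - i)) \<in> range fls_of_param_poly" by blast
qed

lemma param_ring_poly_power: "param_ring_poly p \<Longrightarrow> param_ring_poly (p ^ n)"
  by (induction n) (simp_all add: param_ring_poly_1 param_ring_poly_mult)

lemma param_ring_poly_prod:
  "(\<And>i. i \<in> I \<Longrightarrow> param_ring_poly (f i)) \<Longrightarrow> param_ring_poly (\<Prod>i\<in>I. f i)"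
  by (induction I rule: infinite_finite_induct) (simp_all add: param_ring_poly_1 param_ring_poly_mult)

lemma param_ring_poly_X: "param_ring_poly [:0, 1:]"
  by (simp add: param_ring_poly_pCons param_ring_poly_0 range_fls_of_param_poly)

lemma param_ring_poly_fls_iter_poly: "param_ring_poly (fls_iter_poly j)"
  unfolding fls_iter_poly_def
proof (induction j)
  case (Suc j)
  have "param_ring_poly [:fls_c:]"
    by (simp add: param_ring_poly_pCons param_ring_poly_0 range_fls_of_param_poly)
  with Suc show ?case by (simp add: param_ring_poly_add param_ring_poly_power)
qed (simp add: param_ring_poly_X)

lemma poly_param_ring_poly:
  assumes "param_ring_poly p" "x \<in> range fls_of_param_poly"
  shows "poly p x \<in> range fls_of_param_poly"
  using assms(1)
  by (induction p)
     (auto simp: param_ring_poly_pCons intro!: range_fls_of_param_poly assms(2))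

text \<open>The periodic points are the roots of \<open>f^k(z) - z\<close>, whose coefficients lie
  in C[c]; Newton's identities keep the power sums there.\<close>

lemma power_sum_fls_periodic:
  assumes "k \<ge> 1"
  shows "(\<Sum>z\<in>fls_periodic k. z ^ s) \<in> range fls_of_param_poly"
proof -
  have "param_ring_poly (fls_iter_poly k - [:0, 1:])"
    by (intro param_ring_poly_diff param_ring_poly_fls_iter_poly param_ring_poly_X)
  then have "(\<Sum>z\<in>#mset_set (fls_periodic k). z ^ s) \<in> range fls_of_param_poly"
    unfolding fls_iter_poly_split[OF assms] param_ring_poly_def
    by (intro power_sums_in_subring range_fls_of_param_poly) auto
  then show ?thesis by (simp add: sum_unfold_sum_mset)
qed

text \<open>The differentials \<open>p(c) dc\<close> with \<open>p\<close> a polynomial: the error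
  terms that taking the residue at infinity discards.\<close>

definition param_differential :: "complex fls \<Rightarrow> bool" where
  "param_differential f \<longleftrightarrow> (\<exists>p. f = fls_of_param_poly p * fls_deriv fls_c)"

lemma param_differential_0: "param_differential 0"
  unfolding param_differential_def by (intro exI[of _ 0]) simp

lemma param_differential_add:
  "param_differential f \<Longrightarrow> param_differential g \<Longrightarrow> param_differential (f + g)"
  unfolding param_differential_def by (metis distrib_right fls_of_param_poly_add)

lemma param_differential_diff:
  "param_differential f \<Longrightarrow> param_differential g \<Longrightarrow> param_differential (f - g)"
  unfolding param_differential_def by (metis left_diff_distrib fls_of_param_poly_diff)

lemma param_differential_mult:
  "x \<in> range fls_of_param_poly \<Longrightarrow> param_differential f \<Longrightarrow> param_differential (x * f)"
  unfolding param_differential_def by (metis rangeE mult.assoc fls_of_param_poly_mult)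

lemma param_differential_deriv:
  "x \<in> range fls_of_param_poly \<Longrightarrow> param_differential (fls_deriv x)"
  unfolding param_differential_def by (metis rangeE fls_deriv_param_poly)

lemma fls_residue_param_differential: "param_differential f \<Longrightarrow> fls_residue f = 0"
  unfolding param_differential_def by (metis fls_residue_param_poly_deriv_c)

text \<open>Although the individual periodic points are not polynomials in \<open>c\<close>, their traces are,
  so replacing \<open>w\<close> by the nearby periodic point \<open>z\<close> inside \<open>T\<close> does not change the residue.\<close>

lemma param_differential_trace:
  assumes "k \<ge> 1" and w: "w \<in> range fls_of_param_poly" "w \<notin> fls_periodic k"
    and T: "param_ring_poly T"
  shows "param_differential
    (\<Sum>z\<in>fls_periodic k. z ^ s * ((poly T w - poly T z) * fls_dlog (w - z)))"
  using T
proof (induction T arbitrary: s)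
  case 0
  then show ?case by (simp add: param_differential_0)
next
  case (pCons a T)
  have T: "param_ring_poly T" using pCons.prems by (simp add: param_ring_poly_pCons)
  have "(\<Sum>z\<in>fls_periodic k. z ^ s * ((poly (pCons a T) w - poly (pCons a T) z) * fls_dlog (w - z)))
      = (\<Sum>z\<in>fls_periodic k. poly T w * (z ^ s * fls_deriv w - z ^ s * fls_deriv z)
          + z ^ Suc s * ((poly T w - poly T z) * fls_dlog (w - z)))"
  proof (intro sum.cong refl)
    fix z assume "z \<in> fls_periodic k"
    then have "w - z \<noteq> 0" using w(2) by auto
    then have d: "(w - z) * fls_dlog (w - z) = fls_deriv w - fls_deriv z"
      by (simp add: fls_dlog_def)
    \<comment> \<open>The first part cancels the denominator of \<open>fls_dlog (w - z)\<close>; the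
      second is the claim for \<open>T\<close> with \<open>s\<close> raised by one, which is why
      \<open>s\<close> varies in the induction.\<close>
    have "poly (pCons a T) w - poly (pCons a T) z
        = (w - z) * poly T w + z * (poly T w - poly T z)"
      by (simp add: algebra_simps)
    then have "z ^ s * ((poly (pCons a T) w - poly (pCons a T) z) * fls_dlog (w - z))
        = poly T w * (z ^ s * ((w - z) * fls_dlog (w - z)))
          + z ^ Suc s * ((poly T w - poly T z) * fls_dlog (w - z))"
      by (simp add: distrib_right distrib_left mult_ac)
    then show "z ^ s * ((poly (pCons a T) w - poly (pCons a T) z) * fls_dlog (w - z))
        = poly T w * (z ^ s * fls_deriv w - z ^ s * fls_deriv z)
          + z ^ Suc s * ((poly T w - poly T z) * fls_dlog (w - z))"
      unfolding d by (simp only: right_diff_distrib)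
  qed
  also have "\<dots> = poly T w * ((\<Sum>z\<in>fls_periodic k. z ^ s) * fls_deriv w
        - (\<Sum>z\<in>fls_periodic k. z ^ s * fls_deriv z))
      + (\<Sum>z\<in>fls_periodic k. z ^ Suc s * ((poly T w - poly T z) * fls_dlog (w - z)))"
    by (simp only: sum.distrib sum_subtractf sum_distrib_left sum_distrib_right right_diff_distrib)
  \<comment> \<open>The trace of \<open>z^s dz\<close> is the differential of a power sum, divided
    by \<open>s + 1\<close>, and hence polynomial.\<close>
  also have "(\<Sum>z\<in>fls_periodic k. z ^ s * fls_deriv z)
      = inverse (of_nat (Suc s)) * fls_deriv (\<Sum>z\<in>fls_periodic k. z ^ Suc s)"
  proof -
    have "fls_deriv (\<Sum>z\<in>fls_periodic k. z ^ Suc s)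
        = of_nat (Suc s) * (\<Sum>z\<in>fls_periodic k. z ^ s * fls_deriv z)"
      unfolding fls_deriv_sum fls_deriv_power sum_distrib_left
      by (intro sum.cong refl) (simp only: diff_Suc_1 mult.assoc)
    moreover have "(of_nat (Suc s) :: complex fls) \<noteq> 0" by (simp only: of_nat_eq_0_iff)
    ultimately show ?thesis by (simp only: mult.assoc[symmetric] left_inverse mult_1_left not_False_eq_True)
  qed
  also have "param_differential (poly T w * ((\<Sum>z\<in>fls_periodic k. z ^ s) * fls_deriv w
        - inverse (of_nat (Suc s)) * fls_deriv (\<Sum>z\<in>fls_periodic k. z ^ Suc s))
      + (\<Sum>z\<in>fls_periodic k. z ^ Suc s * ((poly T w - poly T z) * fls_dlog (w - z))))"
  proof (intro param_differential_add param_differential_mult param_differential_diff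
      param_differential_deriv pCons.IH T power_sum_fls_periodic assms poly_param_ring_poly)
    have "inverse (of_nat (Suc s)) = fls_of_param_poly [:inverse (of_nat (Suc s)):]"
      by (intro inverse_unique) (simp add: fls_of_nat del: of_nat_Suc)
    then show "inverse (of_nat (Suc s)) \<in> range fls_of_param_poly" by (metis rangeI)
  qed
  finally show ?case .
qed

section \<open>Power sums of multipliers\<close>

definition param_orbit :: "nat \<Rightarrow> complex poly" where
  "param_orbit j = map_poly of_int (crit_orbit j)"

lemma param_orbit_add: "param_orbit (i + j) = quad_iter [:0, 1:] i (param_orbit j)"
  by (simp add: param_orbit_def map_poly_of_int_crit_orbit quad_iter_add)

lemma param_orbit_Suc: "param_orbit (Suc j) = (param_orbit j)\<^sup>2 + [:0, 1:]"
  using param_orbit_add[of 1 j] by simp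

lemma map_poly_orbit_sum: "map_poly of_int (orbit_sum M k) = param_orbit (M + k) + param_orbit M"
  by (simp add: param_orbit_def orbit_sum_def map_poly_of_int_add)

text \<open>A difference of two squares. The roots at level \<open>Suc M\<close> are thus those at
  level \<open>M\<close> together with the roots of \<open>orbit_sum M k\<close>.\<close>

lemma param_orbit_diff_Suc:
  "param_orbit (Suc M + k) - param_orbit (Suc M)
     = (param_orbit (M + k) - param_orbit M) * map_poly of_int (orbit_sum M k)"
  by (simp add: map_poly_orbit_sum param_orbit_Suc power2_eq_square algebra_simps)

lemma param_orbit_diff_nonzero:
  assumes "k \<ge> 1"
  shows "param_orbit (M + k) - param_orbit M \<noteq> 0"
proof (induction M)
  case 0
  then show ?case using orbit_sum_nonzero[OF assms, of 0]
    by (simp add: param_orbit_def orbit_sum_0 map_poly_of_int_eq_0_iff)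
next
  case (Suc M)
  then show ?case unfolding param_orbit_diff_Suc
    using orbit_sum_nonzero[OF assms, of M] by (simp add: map_poly_of_int_eq_0_iff)
qed

definition orbit_multiplier :: "nat \<Rightarrow> nat \<Rightarrow> complex poly" where
  "orbit_multiplier j k = 2 ^ k * (\<Prod>i<k. param_orbit (j + i))"

lemma multiplier_eq: "multiplier m n \<alpha> = poly (orbit_multiplier m n) \<alpha>"
  by (simp add: multiplier_def orbit_multiplier_def param_orbit_def poly_prod)

text \<open>The sums \<open>N_j\<close> of the overview, with \<open>k\<close> and \<open>e\<close>
  made explicit.\<close>

definition periodic_power_sum :: "nat \<Rightarrow> nat \<Rightarrow> nat \<Rightarrow> complex" where
  "periodic_power_sum j k e =
     (\<Sum>\<alpha>\<in>#proots (param_orbit (j + k) - param_orbit j). poly (orbit_multiplier j k) \<alpha> ^ e)"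

text \<open>By the chain rule this is the \<open>e\<close>-th power of the derivative of
  \<open>f^k\<close>, as a polynomial in the point \<open>z\<close>.\<close>

definition multiplier_power_poly :: "nat \<Rightarrow> nat \<Rightarrow> complex fls poly" where
  "multiplier_power_poly k e = (2 ^ k * (\<Prod>j<k. fls_iter_poly j)) ^ e"

lemma param_ring_multiplier_power_poly: "param_ring_poly (multiplier_power_poly k e)"
proof -
  have "param_ring_poly 2"
    using param_ring_poly_add[OF param_ring_poly_1 param_ring_poly_1] by simp
  then show ?thesis unfolding multiplier_power_poly_def
    by (intro param_ring_poly_power param_ring_poly_mult param_ring_poly_prod
        param_ring_poly_fls_iter_poly)
qed

lemma fls_of_orbit_multiplier_power:
  "fls_of_param_poly (orbit_multiplier j k ^ e)
     = poly (multiplier_power_poly k e) (fls_of_param_poly (param_orbit j))"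
proof -
  have "fls_of_param_poly 2 = 2"
    using fls_of_param_poly_add[of 1 1] by (simp del: fls_of_param_poly_add)
  moreover have "fls_of_param_poly (param_orbit (j + i))
      = poly (fls_iter_poly i) (fls_of_param_poly (param_orbit j))" for i
    by (subst add.commute)
       (simp add: param_orbit_add fls_of_param_poly_quad_iter poly_fls_iter_poly)
  ultimately show ?thesis
    by (simp add: multiplier_power_poly_def orbit_multiplier_def poly_prod)
qed

lemma fls_param_orbit_subdegree:
  assumes "j \<ge> 1"
  shows "fls_subdegree (fls_of_param_poly (param_orbit j)) = - (2 ^ j)"
proof -
  have "param_orbit ((j - 1) + 1) = quad_iter [:0, 1:] (j - 1) (param_orbit 1)"
    by (rule param_orbit_add)
  moreover have "param_orbit 1 = [:0, 1:]"
    using param_orbit_Suc[of 0] by (simp add: param_orbit_def)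
  ultimately have "fls_of_param_poly (param_orbit j) = quad_iter fls_c (j - 1) fls_c"
    using assms by (simp add: fls_of_param_poly_quad_iter)
  then show ?thesis
    using quad_iter_subdegree[of fls_c "j - 1"] assms
    by (cases j) (simp_all add: fls_c_subdegree)
qed

lemma param_orbit_not_periodic:
  assumes "j \<ge> 1" "k \<ge> 1"
  shows "fls_of_param_poly (param_orbit j) \<notin> fls_periodic k"
proof
  assume "fls_of_param_poly (param_orbit j) \<in> fls_periodic k"
  then have "fls_vanishes_below (-1) (fls_of_param_poly (param_orbit j))"
    by (rule fls_periodic_vanishes_below[OF _ assms(2)])
  moreover have "fls_of_param_poly (param_orbit j) \<noteq> 0"
    using fls_param_orbit_subdegree[OF assms(1)] by auto
  ultimately have "(2::int) ^ j \<le> 1"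
    using fls_param_orbit_subdegree[OF assms(1)] by (simp add: fls_vanishes_below_iff)
  moreover have "(1::int) < 2 ^ j" using assms(1) by (intro one_less_power) auto
  ultimately show False by linarith
qed

text \<open>Let \<open>T\<close> be the polynomial \<open>multiplier_power_poly k e\<close>. The
  residue formula for root sums first produces \<open>T(w)\<close>. The trace lemma replaces it by
  \<open>T(z)\<close>, whose pole has order at most \<open>k * e\<close> whatever \<open>j\<close>
  is; this makes the later order estimate possible.\<close>

lemma periodic_power_sum_eq_residue:
  assumes "j \<ge> 1" "k \<ge> 1"
  defines "w \<equiv> fls_of_param_poly (param_orbit j)"
  shows "- 2 * periodic_power_sum j k e = fls_residue
    (\<Sum>z\<in>fls_periodic k. poly (multiplier_power_poly k e) z * fls_dlog (w - z))"
proof -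
  let ?T = "multiplier_power_poly k e"
  have wnot: "w \<notin> fls_periodic k" unfolding w_def by (rule param_orbit_not_periodic[OF assms(1,2)])
  have "fls_of_param_poly (param_orbit (j + k) - param_orbit j) = quad_iter fls_c k w - w"
    by (subst add.commute) (simp add: param_orbit_add fls_of_param_poly_quad_iter w_def)
  also have "\<dots> = (\<Prod>z\<in>fls_periodic k. w - z)" by (rule quad_iter_minus_self[OF assms(2)])
  finally have prod: "fls_of_param_poly (param_orbit (j + k) - param_orbit j)
      = (\<Prod>z\<in>fls_periodic k. w - z)" .
  have dlog: "fls_dlog (\<Prod>z\<in>fls_periodic k. w - z) = (\<Sum>z\<in>fls_periodic k. fls_dlog (w - z))"
    using wnot by (intro fls_dlog_prod) auto
  have "- 2 * periodic_power_sum j k e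
      = fls_residue (poly ?T w * (\<Sum>z\<in>fls_periodic k. fls_dlog (w - z)))"
    using sum_proots_eq_residue[OF param_orbit_diff_nonzero[OF assms(2)], of "orbit_multiplier j k ^ e" j]
    unfolding fls_of_orbit_multiplier_power prod dlog periodic_power_sum_def
    by (simp only: poly_power w_def)
  also have "poly ?T w * (\<Sum>z\<in>fls_periodic k. fls_dlog (w - z))
      = (\<Sum>z\<in>fls_periodic k. z ^ 0 * ((poly ?T w - poly ?T z) * fls_dlog (w - z)))
        + (\<Sum>z\<in>fls_periodic k. poly ?T z * fls_dlog (w - z))"
    unfolding sum_distrib_left sum.distrib[symmetric]
    by (intro sum.cong refl) (simp add: algebra_simps)
  also have "fls_residue \<dots>
      = fls_residue (\<Sum>z\<in>fls_periodic k. poly ?T z * fls_dlog (w - z))"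
    using fls_residue_param_differential[OF param_differential_trace[OF assms(2) _ wnot
        param_ring_multiplier_power_poly]]
    by (simp only: fls_residue_add w_def rangeI add_0_left)
  finally show ?thesis .
qed

section \<open>Order estimates and the recurrence for the \<open>N_j\<close>\<close>

lemma multiplier_power_poly_vanishes_below:
  assumes "z \<in> fls_periodic k" "k \<ge> 1"
  shows "fls_vanishes_below (- int (k * e)) (poly (multiplier_power_poly k e) z)"
proof -
  have "fls_vanishes_below (int (card {..<k}) * - 1) (\<Prod>j<k. quad_iter fls_c j z)"
    using assms by (intro fls_vanishes_below_prod fls_periodic_vanishes_below[of _ k]
        fls_periodic_quad_iter)
  moreover have "fls_vanishes_below 0 (2 ^ k :: complex fls)"
    by (intro fls_vanishes_below_subdegree) (simp add: fls_subdegree_pow)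
  ultimately have "fls_vanishes_below (0 + int (card {..<k}) * - 1) (2 ^ k * (\<Prod>j<k. quad_iter fls_c j z))"
    by (intro fls_vanishes_below_mult)
  from fls_vanishes_below_power[OF this, of e] show ?thesis
    by (simp add: multiplier_power_poly_def poly_prod poly_fls_iter_poly mult.commute)
qed

text \<open>Factor out \<open>w^2\<close>: the correction \<open>c / w^2\<close> has order
  \<open>2 * d - 2\<close>, and its logarithmic derivative loses one.\<close>

lemma fls_dlog_square_plus:
  assumes "fls_subdegree w = - d" "d \<ge> 2"
  shows "fls_vanishes_below (2 * d - 3) (fls_dlog (w\<^sup>2 + fls_c) - 2 * fls_dlog w)"
proof -
  have w: "w \<noteq> 0" using assms by auto
  have "fls_vanishes_below (2 * d - 2) (fls_c / w\<^sup>2)"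
    using fls_vanishes_below_divide[of "-2" fls_c "w\<^sup>2"] w assms(1)
    by (simp add: fls_vanishes_below_subdegree fls_c_subdegree fls_subdegree_pow)
  from fls_dlog_one_plus[OF this] assms(2)
  have v: "1 + fls_c / w\<^sup>2 \<noteq> 0" "fls_vanishes_below (2 * d - 2 - 1) (fls_dlog (1 + fls_c / w\<^sup>2))"
    by simp_all
  have "w\<^sup>2 + fls_c = w\<^sup>2 * (1 + fls_c / w\<^sup>2)" using w by (simp add: field_simps)
  then have "fls_dlog (w\<^sup>2 + fls_c) = fls_dlog (w\<^sup>2 * (1 + fls_c / w\<^sup>2))" by (rule arg_cong)
  also have "\<dots> = fls_dlog (w\<^sup>2) + fls_dlog (1 + fls_c / w\<^sup>2)"
    using w v(1) by (intro fls_dlog_mult) auto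
  also have "fls_dlog (w\<^sup>2) = 2 * fls_dlog w" using fls_dlog_power[OF w, of 2] by simp
  finally show ?thesis using v(2) by simp
qed

text \<open>Factor out \<open>w\<close>: the correction \<open>z / w\<close> has order at least
  \<open>d - 1\<close>.\<close>

lemma fls_dlog_minus_small:
  assumes "fls_subdegree w = - d" "d \<ge> 2" "fls_vanishes_below (-1) z"
  shows "fls_vanishes_below (d - 2) (fls_dlog (w - z) - fls_dlog w)"
proof -
  have w: "w \<noteq> 0" using assms by auto
  have "fls_vanishes_below (- 1) (- z)" using assms(3) by (simp add: fls_vanishes_below_def)
  then have "fls_vanishes_below (d - 1) (- z / w)"
    using fls_vanishes_below_divide[of "-1" "- z" w] w assms(1) by simp
  from fls_dlog_one_plus[OF this] assms(2)
  have v: "1 + - z / w \<noteq> 0" "fls_vanishes_below (d - 1 - 1) (fls_dlog (1 + - z / w))"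
    by simp_all
  have "w - z = w * (1 + - z / w)" using w by (simp add: field_simps)
  then have "fls_dlog (w - z) = fls_dlog (w * (1 + - z / w))" by (rule arg_cong)
  also have "\<dots> = fls_dlog w + fls_dlog (1 + - z / w)" by (rule fls_dlog_mult[OF w v(1)])
  finally show ?thesis using v(2) by simp
qed

text \<open>Up to order \<open>d - 2\<close> with \<open>d = 2 ^ j\<close>,
  \<open>fls_dlog (w i - z)\<close> agrees with \<open>fls_dlog (w i)\<close>, and the latter with
  twice its predecessor. The weights 1, -3, 2 form the difference of two consecutive doubling
  relations. Multiplied by the power of the multiplier, whose pole has order at most
  \<open>k * e\<close>, the combination has order at least \<open>d - 2 - k * e\<close>, which is
  positive, so it has no residue.\<close>

lemma periodic_power_sum_recurrence:
  assumes "j \<ge> 1" "k \<ge> 1" "k * e + 3 \<le> 2 ^ j"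
  shows "periodic_power_sum (j + 2) k e + 2 * periodic_power_sum j k e
    = 3 * periodic_power_sum (j + 1) k e"
proof -
  define w where "w i = fls_of_param_poly (param_orbit (j + i))" for i
  define d where "d = (2::int) ^ j"
  let ?T = "multiplier_power_poly k e"
  let ?N = "\<lambda>i. periodic_power_sum (j + i) k e"
  have wSuc: "w (Suc i) = (w i)\<^sup>2 + fls_c" for i
    by (simp add: w_def param_orbit_Suc)
  have d: "d \<ge> int (k * e) + 3"
    using assms(3) unfolding d_def by (metis of_nat_add of_nat_le_iff of_nat_numeral of_nat_power)
  then have d3: "d \<ge> 3" by linarith
  have sub: "fls_subdegree (w i) = - (2 ^ i * d)" for i
    using assms(1) fls_param_orbit_subdegree[of "j + i"] by (simp add: w_def d_def power_add mult.commute)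
  have ge: "d \<le> 2 ^ i * d" for i :: nat
    using d3 mult_right_mono[of 1 "2 ^ i" d] by simp
  define \<eta> where "\<eta> i = fls_dlog (w (Suc i)) - 2 * fls_dlog (w i)" for i
  have \<eta>: "fls_vanishes_below (d - 2) (\<eta> i)" for i
  proof -
    have "fls_vanishes_below (2 * (2 ^ i * d) - 3) (\<eta> i)"
      unfolding \<eta>_def wSuc using d3 ge[of i] by (intro fls_dlog_square_plus sub) linarith
    then show ?thesis by (rule fls_vanishes_below_mono) (use d3 ge[of i] in linarith)
  qed
  define \<delta> where "\<delta> i z = fls_dlog (w i - z) - fls_dlog (w i)" for i z
  have \<delta>: "fls_vanishes_below (d - 2) (\<delta> i z)" if "z \<in> fls_periodic k" for i z
  proof -
    have "fls_vanishes_below (2 ^ i * d - 2) (\<delta> i z)"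
      unfolding \<delta>_def using d3 ge[of i] fls_periodic_vanishes_below[OF that assms(2)]
      by (intro fls_dlog_minus_small sub) linarith+
    then show ?thesis by (rule fls_vanishes_below_mono) (use ge[of i] in linarith)
  qed
  define \<Delta> where "\<Delta> z = fls_dlog (w 2 - z) + 2 * fls_dlog (w 0 - z) - 3 * fls_dlog (w 1 - z)" for z
  have \<Delta>: "fls_vanishes_below (d - 2) (\<Delta> z)" if "z \<in> fls_periodic k" for z
  proof -
    have "\<Delta> z = (\<delta> 2 z + (\<delta> 0 z + \<delta> 0 z) - (\<delta> 1 z + \<delta> 1 z + \<delta> 1 z)) + (\<eta> 1 - \<eta> 0)"
      by (simp add: \<Delta>_def \<delta>_def \<eta>_def numeral_2_eq_2 algebra_simps)
    also have "fls_vanishes_below (d - 2) \<dots>"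
      by (intro fls_vanishes_below_add fls_vanishes_below_diff \<delta> \<eta> that)
    finally show ?thesis .
  qed
  have N: "- 2 * ?N i = fls_residue (\<Sum>z\<in>fls_periodic k. poly ?T z * fls_dlog (w i - z))" for i
    unfolding w_def using assms by (intro periodic_power_sum_eq_residue) auto
  have "- 2 * (?N 2 + 2 * ?N 0 - 3 * ?N 1) = - 2 * ?N 2 + 2 * (- 2 * ?N 0) - 3 * (- 2 * ?N 1)"
    by simp
  also have "\<dots> = fls_residue (\<Sum>z\<in>fls_periodic k. poly ?T z * \<Delta> z)"
    unfolding N fls_residue_sum sum_distrib_left sum.distrib[symmetric] sum_subtractf[symmetric]
  proof (intro sum.cong refl)
    fix z
    have "poly ?T z * \<Delta> z = poly ?T z * fls_dlog (w 2 - z)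
        + fls_const 2 * (poly ?T z * fls_dlog (w 0 - z)) - fls_const 3 * (poly ?T z * fls_dlog (w 1 - z))"
      by (simp add: \<Delta>_def algebra_simps)
    then show "fls_residue (poly ?T z * fls_dlog (w 2 - z)) + 2 * fls_residue (poly ?T z * fls_dlog (w 0 - z))
        - 3 * fls_residue (poly ?T z * fls_dlog (w 1 - z)) = fls_residue (poly ?T z * \<Delta> z)"
      by (simp only: fls_residue_def fls_minus_nth fls_plus_nth fls_mult_const_nth)
  qed
  also have "\<dots> = 0"
    unfolding fls_residue_sum
  proof (intro sum.neutral ballI fls_residue_eq_0)
    fix z assume z: "z \<in> fls_periodic k"
    show "fls_vanishes_below 0 (poly ?T z * \<Delta> z)"
      using fls_vanishes_below_mult[OF multiplier_power_poly_vanishes_below[OF z assms(2), of e] \<Delta>[OF z]]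
      by (rule fls_vanishes_below_mono) (use d in linarith)
  qed
  finally have "?N 2 + 2 * ?N 0 - 3 * ?N 1 = 0" unfolding mult_eq_0_iff by simp
  then show ?thesis by simp
qed

section \<open>From periodic parameters to the roots of \<open>G_{m,n}\<close>\<close>

lemma prod_lessThan_add:
  fixes f :: "nat \<Rightarrow> 'a::comm_monoid_mult"
  shows "(\<Prod>i<a + b. f i) = (\<Prod>i<a. f i) * (\<Prod>i<b. f (a + i))"
  by (induction b) (simp_all add: mult.assoc)

lemma prod_lessThan_periodic:
  fixes f :: "nat \<Rightarrow> 'a::comm_monoid_mult"
  assumes "\<And>i. f (k + i) = f i"
  shows "(\<Prod>i<k * q. f i) = (\<Prod>i<k. f i) ^ q"
proof (induction q)
  case (Suc q)
  have "(\<Prod>i<k * Suc q. f i) = (\<Prod>i<k. f i) * (\<Prod>i<k * q. f (k + i))"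
    by (simp only: mult_Suc_right prod_lessThan_add)
  then show ?case using Suc assms by simp
qed simp

text \<open>The orbit of \<open>a_j\<close> at this parameter has period dividing \<open>k\<close>:
  \<open>k * q\<close> steps run through \<open>k\<close> steps \<open>q\<close> times, and starting
  one step later permutes the factors cyclically.\<close>

lemma orbit_multiplier_periodic:
  assumes "poly (param_orbit (j + k)) \<alpha> = poly (param_orbit j) \<alpha>"
  shows "poly (orbit_multiplier j (k * q)) \<alpha> = poly (orbit_multiplier j k) \<alpha> ^ q"
    and "k \<ge> 1 \<Longrightarrow> poly (orbit_multiplier (Suc j) k) \<alpha> = poly (orbit_multiplier j k) \<alpha>"
proof -
  have per: "poly (param_orbit (j + (k + i))) \<alpha> = poly (param_orbit (j + i)) \<alpha>" for i
  proof (induction i)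
    case (Suc i)
    then show ?case by (simp add: param_orbit_Suc)
  qed (use assms in simp)
  have "(\<Prod>i<k * q. poly (param_orbit (j + i)) \<alpha>) = (\<Prod>i<k. poly (param_orbit (j + i)) \<alpha>) ^ q"
    by (rule prod_lessThan_periodic) (rule per)
  then show "poly (orbit_multiplier j (k * q)) \<alpha> = poly (orbit_multiplier j k) \<alpha> ^ q"
    by (simp add: orbit_multiplier_def poly_prod power_mult power_mult_distrib)
  assume "k \<ge> 1"
  then obtain r where "k = Suc r" by (cases k) auto
  then show "poly (orbit_multiplier (Suc j) k) \<alpha> = poly (orbit_multiplier j k) \<alpha>"
    using assms prod.lessThan_Suc_shift[of "\<lambda>i. poly (param_orbit (j + i)) \<alpha>" r]
    by (simp add: orbit_multiplier_def poly_prod mult_ac)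
qed

lemma sum_proots_cong:
  assumes "p \<noteq> 0" "\<And>\<alpha>. poly p \<alpha> = 0 \<Longrightarrow> f \<alpha> = g \<alpha>"
  shows "(\<Sum>\<alpha>\<in>#proots p. f \<alpha>) = (\<Sum>\<alpha>\<in>#proots p. g \<alpha>)"
  using assms by (intro arg_cong[of _ _ sum_mset] image_mset_cong) auto

text \<open>By \<open>param_orbit_diff_Suc\<close> the sum at level \<open>Suc M\<close> is the sum
  over the roots of \<open>orbit_sum M k\<close> plus that over the roots at level \<open>M\<close>,
  where the cyclic shift identifies the multipliers.\<close>

lemma sum_proots_orbit_sum:
  assumes "k \<ge> 1"
  shows "(\<Sum>\<alpha>\<in>#proots (map_poly of_int (orbit_sum M k)). multiplier (Suc M) (k * q) \<alpha> ^ s)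
    = periodic_power_sum (Suc M) k (q * s) - periodic_power_sum M k (q * s)"
proof -
  let ?p = "param_orbit (M + k) - param_orbit M" and ?b = "map_poly of_int (orbit_sum M k) :: complex poly"
  have nz: "?p \<noteq> 0" "?b \<noteq> 0"
    using param_orbit_diff_nonzero[OF assms] orbit_sum_nonzero[OF assms]
    by (simp_all add: map_poly_of_int_eq_0_iff)
  have "(\<Sum>\<alpha>\<in>#proots ?b. multiplier (Suc M) (k * q) \<alpha> ^ s)
      = (\<Sum>\<alpha>\<in>#proots ?b. poly (orbit_multiplier (Suc M) k) \<alpha> ^ (q * s))"
  proof (rule sum_proots_cong[OF nz(2)])
    fix \<alpha> assume "poly ?b \<alpha> = 0"
    then have "poly (param_orbit (Suc M + k) - param_orbit (Suc M)) \<alpha> = 0"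
      unfolding param_orbit_diff_Suc by simp
    then have "poly (param_orbit (Suc M + k)) \<alpha> = poly (param_orbit (Suc M)) \<alpha>" by simp
    from orbit_multiplier_periodic(1)[OF this, of q]
    show "multiplier (Suc M) (k * q) \<alpha> ^ s = poly (orbit_multiplier (Suc M) k) \<alpha> ^ (q * s)"
      by (simp add: multiplier_eq power_mult)
  qed
  moreover have "(\<Sum>\<alpha>\<in>#proots ?p. poly (orbit_multiplier (Suc M) k) \<alpha> ^ (q * s))
      = periodic_power_sum M k (q * s)"
    unfolding periodic_power_sum_def
  proof (rule sum_proots_cong[OF nz(1)])
    fix \<alpha> assume "poly ?p \<alpha> = 0"
    then have "poly (param_orbit (M + k)) \<alpha> = poly (param_orbit M) \<alpha>" by simp
    from orbit_multiplier_periodic(2)[OF this assms]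
    show "poly (orbit_multiplier (Suc M) k) \<alpha> ^ (q * s) = poly (orbit_multiplier M k) \<alpha> ^ (q * s)"
      by simp
  qed
  moreover have "periodic_power_sum (Suc M) k (q * s)
      = (\<Sum>\<alpha>\<in>#proots ?p. poly (orbit_multiplier (Suc M) k) \<alpha> ^ (q * s))
        + (\<Sum>\<alpha>\<in>#proots ?b. poly (orbit_multiplier (Suc M) k) \<alpha> ^ (q * s))"
    unfolding periodic_power_sum_def param_orbit_diff_Suc proots_mult[OF nz] by simp
  ultimately show ?thesis by simp
qed

text \<open>The factors \<open>a_k\<close> in \<open>G_{m,n}\<close> contribute nothing: at their
  roots the cycle passes through 0, so the multiplier vanishes, and so does its \<open>s\<close>-th
  power since \<open>s \<ge> 1\<close>.\<close>

lemma multiplier_power_sum: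
  assumes "m \<ge> 1" "n \<ge> 1" "s \<ge> 1"
  shows "(\<Sum>\<alpha>\<in>#proots (map_poly of_int (misiurewicz_poly m n)). multiplier m n \<alpha> ^ s)
    = (\<Sum>k | k dvd n. of_int (moebius_mu (n div k)) *
        (periodic_power_sum m k (n div k * s) - periodic_power_sum (m - 1) k (n div k * s)))"
proof -
  obtain M where m: "m = Suc M" using assms(1) by (cases m) auto
  have pos: "k \<ge> 1" if "k dvd n" for k using that assms(2) by (cases k) auto
  have zero: "(\<Sum>\<alpha>\<in>#proots (map_poly of_int (crit_orbit k)). multiplier m n \<alpha> ^ s) = 0"
    if "k dvd n" "n dvd m - 1" for k
  proof -
    have nz: "map_poly of_int (crit_orbit k) \<noteq> (0 :: complex poly)"
      using orbit_sum_nonzero[OF pos[OF that(1)], of 0] by (simp add: orbit_sum_0 map_poly_of_int_eq_0_iff)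
    \<comment> \<open>The index is \<open>(m - 1) + n\<close>, a sum of two multiples of
      \<open>k\<close>; it belongs to the last factor of the multiplier.\<close>
    have "k dvd m + (n - 1)" using that assms m by (auto intro: dvd_trans)
    then obtain g where g: "crit_orbit (m + (n - 1)) = crit_orbit k * g"
      using crit_orbit_dvd by blast
    have "multiplier m n \<alpha> = 0" if "poly (map_poly of_int (crit_orbit k)) \<alpha> = 0" for \<alpha>
    proof -
      have "poly (map_poly of_int (crit_orbit (m + (n - 1)))) \<alpha> = 0"
        using that unfolding g map_poly_of_int_mult by simp
      then show ?thesis using assms(2) by (auto simp: multiplier_def intro!: bexI[of _ "n - 1"])
    qed
    then have "(\<Sum>\<alpha>\<in>#proots (map_poly of_int (crit_orbit k)). multiplier m n \<alpha> ^ s)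
        = (\<Sum>\<alpha>\<in>#proots (map_poly of_int (crit_orbit k) :: complex poly). 0)"
      using assms(3) by (intro sum_proots_cong nz) simp
    then show ?thesis by simp
  qed
  have B: "(\<Sum>\<alpha>\<in>#proots (map_poly of_int (orbit_sum (m - 1) k)). multiplier m n \<alpha> ^ s)
      = periodic_power_sum m k (n div k * s) - periodic_power_sum (m - 1) k (n div k * s)"
    if "k dvd n" for k
    using sum_proots_orbit_sum[OF pos[OF that], of M "n div k" s] that m by simp
  show ?thesis
    unfolding sum_proots_misiurewicz_poly[OF assms(1,2)] using zero B by simp
qed

text \<open>With \<open>e = n div k * s\<close> one has \<open>k * e = n * s\<close> for every
  divisor \<open>k\<close>, so a single bound admits the recurrence at \<open>j = m - 1\<close> in
  each term of the Moebius sum.\<close>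

lemma multiplier_power_sum_double:
  assumes "m \<ge> 2" "n \<ge> 1" "s \<ge> 1" "n * s + 3 \<le> 2 ^ (m - 1)"
  shows "(\<Sum>\<alpha>\<in>#proots (map_poly of_int (misiurewicz_poly (m + 1) n)). multiplier (m + 1) n \<alpha> ^ s)
    = 2 * (\<Sum>\<alpha>\<in>#proots (map_poly of_int (misiurewicz_poly m n)). multiplier m n \<alpha> ^ s)"
proof -
  have step: "periodic_power_sum (m + 1) k (n div k * s) - periodic_power_sum m k (n div k * s)
      = 2 * (periodic_power_sum m k (n div k * s) - periodic_power_sum (m - 1) k (n div k * s))"
    if "k dvd n" for k
  proof -
    have "k \<ge> 1" using that assms(2) by (cases k) auto
    moreover have "k * (n div k * s) + 3 \<le> 2 ^ (m - 1)"
      using assms(4) that by (simp add: mult.assoc[symmetric])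
    moreover have "m - 1 + 2 = m + 1" "m - 1 + 1 = m" "m - 1 \<ge> 1" using assms(1) by auto
    ultimately show ?thesis
      using periodic_power_sum_recurrence[of "m - 1" k "n div k * s"] by (simp add: algebra_simps)
  qed
  have "m + 1 \<ge> 1" "m \<ge> 1" using assms(1) by auto
  then show ?thesis
    unfolding multiplier_power_sum[OF \<open>m + 1 \<ge> 1\<close> assms(2,3)]
      multiplier_power_sum[OF \<open>m \<ge> 1\<close> assms(2,3)] sum_distrib_left
    by (intro sum.cong refl)
       (simp only: mem_Collect_eq step add_diff_cancel_right' mult.left_commute)
qed

section \<open>Comparison of coefficients\<close>

lemma multiplier_poly_eq:
  "multiplier_poly m n
     = linear_prod (image_mset (multiplier m n) (proots (map_poly of_int (misiurewicz_poly m n))))"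
  by (simp add: multiplier_poly_def linear_prod_def image_mset.compositionality comp_def)

lemma degree_multiplier_poly: "degree (multiplier_poly m n) = degree (misiurewicz_poly m n)"
  by (simp add: multiplier_poly_eq degree_linear_prod size_proots_complex degree_map_poly_of_int)

lemma coeff_monic_expansion:
  assumes "p = monom 1 k + (\<Sum>i<k. monom (b i) i)" "r < k"
  shows "coeff p r = b r"
  using assms by (simp add: coeff_sum)

theorem theorem3p1:
  fixes m n k l :: nat and b c :: "nat \<Rightarrow> complex"
  assumes "m \<ge> 2" and "n \<ge> 1"
    and "k = 2 * degree (multiplier_poly m n)"
    and "l = degree (multiplier_poly (m + 1) n)"
    and "(multiplier_poly m n)\<^sup>2 = monom 1 k + (\<Sum>i<k. monom (b i) i)"
    and "multiplier_poly (m + 1) n = monom 1 l + (\<Sum>i<l. monom (c i) i)"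
  shows "k = 2 * degree (misiurewicz_poly m n) \<and>
         l = degree (misiurewicz_poly (m + 1) n) \<and>
         (\<forall>i::nat. i \<ge> 1 \<longrightarrow> \<lfloor>real (n * i) / 2\<rfloor> \<le> 2 ^ (m - 2) - 2 \<longrightarrow>
            i \<le> k \<and> i \<le> l \<and> b (k - i) = c (l - i))"
proof (intro conjI allI impI)
  show k: "k = 2 * degree (misiurewicz_poly m n)" and l: "l = degree (misiurewicz_poly (m + 1) n)"
    using assms(3,4) by (simp_all add: degree_multiplier_poly)
  fix i :: nat
  assume i: "i \<ge> 1" "\<lfloor>real (n * i) / 2\<rfloor> \<le> 2 ^ (m - 2) - 2"
  obtain r where r: "m = Suc (Suc r)" using assms(1) by (metis add_2_eq_Suc le_Suc_ex)
  \<comment> \<open>The floor condition means \<open>n * i / 2 < 2 ^ (m - 2) - 1\<close>. Doubled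
    and read in integers, this is the bound required by \<open>multiplier_power_sum_double\<close>
    at \<open>s = i\<close>.\<close>
  have "real (n * i) / 2 < real_of_int (2 ^ (m - 2) - 2) + 1"
    using i(2) by (simp only: floor_le_iff)
  then have "real (n * i + 2) < real (2 ^ (m - 1))" by (simp add: r)
  then have bound: "n * i + 3 \<le> 2 ^ (m - 1)" by (simp only: of_nat_less_iff)
  \<comment> \<open>Both degrees are at least \<open>2 ^ (m - 1) - 1\<close>, so
    \<open>k - i\<close> and \<open>l - i\<close> are genuine differences.\<close>
  have "i \<le> n * i" using assms(2) by simp
  with bound have "i + 1 \<le> 2 ^ (m - 1)" by linarith
  moreover have "(2::nat) ^ (m - 1) \<le> degree (misiurewicz_poly m n) + 1"
      "(2::nat) ^ (m + 1 - 1) \<le> degree (misiurewicz_poly (m + 1) n) + 1"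
    unfolding le_diff_conv[symmetric]
    using assms(1,2) by (intro degree_misiurewicz_poly_ge; simp)+
  moreover have "(2::nat) ^ (m - 1) \<le> 2 ^ (m + 1 - 1)" by (intro power_increasing) auto
  ultimately show ik: "i \<le> k" and il: "i \<le> l" unfolding k l by linarith+
  let ?A = "image_mset (multiplier m n) (proots (map_poly of_int (misiurewicz_poly m n)))"
  let ?B = "image_mset (multiplier (m + 1) n) (proots (map_poly of_int (misiurewicz_poly (m + 1) n)))"
  \<comment> \<open>Squaring lists every multiplier twice, matching the factor 2 between the power
    sums.\<close>
  have P: "(multiplier_poly m n)\<^sup>2 = linear_prod (?A + ?A)"
    by (simp add: multiplier_poly_eq power2_eq_square)
  have Q: "multiplier_poly (m + 1) n = linear_prod ?B" by (rule multiplier_poly_eq)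
  have degP: "degree (linear_prod (?A + ?A)) = k"
    using assms(3) by (simp only: degree_linear_prod size_union multiplier_poly_eq mult_2)
  have degQ: "degree (linear_prod ?B) = l" using assms(4) Q by simp
  have "coeff (reflect_poly (linear_prod (?A + ?A))) i = coeff (reflect_poly (linear_prod ?B)) i"
  proof (rule power_sums_determine_coeffs[where N = i])
    fix s :: nat assume s: "1 \<le> s" "s \<le> i"
    have "n * s \<le> n * i" using s by simp
    then have "n * s + 3 \<le> 2 ^ (m - 1)" using bound by linarith
    from multiplier_power_sum_double[OF assms(1,2) s(1) this]
    show "(\<Sum>a\<in>#?A + ?A. a ^ s) = (\<Sum>a\<in>#?B. a ^ s)"
      by (simp add: image_mset.compositionality comp_def)
  qed simp
  then have "coeff (linear_prod (?A + ?A)) (k - i) = coeff (linear_prod ?B) (l - i)"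
    using ik il by (simp only: coeff_reflect_poly degP degQ not_less[symmetric] if_False)
  moreover have "coeff ((multiplier_poly m n)\<^sup>2) (k - i) = b (k - i)"
    using i(1) ik by (intro coeff_monic_expansion[OF assms(5)]) simp
  moreover have "coeff (multiplier_poly (m + 1) n) (l - i) = c (l - i)"
    using i(1) il by (intro coeff_monic_expansion[OF assms(6)]) simp
  ultimately show "b (k - i) = c (l - i)" unfolding P Q by simp
qed

end
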